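(* Let $B_X$ be the open unit ball of a complex Banach space $X$, let $F:B_X\to\overline{\mathbb{U}}$ be a holomorphic mapping with $$F(z)=a+\sum_{s=1}^{\infty}P_s(z),\qquad z\in B_X,$$ where $P_s(z)=\frac{1}{s!}D^sF(0)(z^s)$, and let $\mu_k,\mu_m:B_X\to B_X$ be Schwarz mappings having $z=0$ as a zero of order $k$ and $m$ respectively. Let $R_{2,m}\in(0,1)$ be the unique root in $(0,1)$ of the equation $r^{3m}-r^{2m}-2r^m+1=0$, and let $R_{2,m,k}\in(0,1)$ be the smallest positive root of the equation $$(1-r^k)\bigl(-1+2r^m+r^{2m}-r^{3m}\bigr)+r^{3k}(1-r^m)(1+r^m)^2=0.$$ For $z\in B_X$ with $\|z\|=r$ put $$\mathcal{A}_F(z,r):=|F(\mu_m(z))|^2+|DF(\mu_m(z))(\mu_m(z))|+\frac{1}{2!}\bigl|D^2F(\mu_m(z))\bigl((\mu_m(z))^2\bigr)\bigr|+\sum_{j=3}^{\infty}|P_j(\mu_k(z))|+\frac{|P_1(\mu_k(z))|^2\,r^k}{1-r^k}+\left(\frac{1}{1+|a|}+\frac{r^k}{1-r^k}\right)\sum_{j=2}^{\infty}|P_j(\mu_k(z))|^2.$$ Then, for each $k,m\in\mathbb{N}$, the inequality $\mathcal{A}_F(z,r)\le 1$ holds for $\|z\|=r\le R_{2,m,k}$. Moreover, fix $z_0\in X$ with $\|z_0\|=1$ and $l_{z_0}\in T(z_0)$, and for $a\in(0,1)$ let $F$ be the function $$F(z)=\frac{a-l_{z_0}(z)}{1-a\,l_{z_0}(z)},\qquad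 z\in B_X;$$ then $\lim_{a\to1^-}\mathcal{A}_F(z,r)=1$.
   Context: $\mathbb{U}=\{\zeta\in\mathbb{C}:|\zeta|<1\}$ and $\overline{\mathbb{U}}$ is its closure. For a holomorphic mapping $F$ between (open subsets of) complex Banach spaces, $D^kF(z)$ denotes the $k$-th Fréchet derivative of $F$ at $z$ (a symmetric $k$-linear map), $DF=D^1F$, and $D^kF(z)(w^k)$ means $D^kF(z)(w,\ldots,w)$ with $w$ repeated $k$ times. Thus $P_s$ is the $s$-homogeneous polynomial in the Taylor expansion of $F$ at $0$, and $a=F(0)$. For $k\in\mathbb{N}=\{1,2,\ldots\}$, $z=0$ is a zero of order $k$ of a holomorphic mapping $\mu$ if $\mu(0)=0$, $D\mu(0)=0,\ldots,D^{k-1}\mu(0)=0$, but $D^k\mu(0)\ne0$. A Schwarz mapping $\mu:B_X\to B_X$ is a holomorphic mapping with $\mu(0)=0$. For $x\in X\setminus\{0\}$, $T(x)$ is the (nonempty) set of continuous linear functionals $\ell_x:X\to\mathbb{C}$ with $\ell_x(x)=\|x\|$ and $\|\ell_x\|=1$. *)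

theory Defs
  imports "HOL-Analysis.Analysis"
begin

class complex_banach = banach +
  fixes scaleC :: "complex \<Rightarrow> 'a \<Rightarrow> 'a"  (infixr "*\<^sub>C" 75)
  assumes scaleC_add_right: "c *\<^sub>C (x + y) = c *\<^sub>C x + c *\<^sub>C y"
    and scaleC_add_left: "(c + d) *\<^sub>C x = c *\<^sub>C x + d *\<^sub>C x"
    and scaleC_scaleC: "c *\<^sub>C d *\<^sub>C x = (c * d) *\<^sub>C x"
    and scaleC_of_real: "complex_of_real t *\<^sub>C x = t *\<^sub>R x"
    and norm_scaleC: "norm (c *\<^sub>C x) = cmod c * norm x"

instantiation complex :: complex_banach
begin

definition scaleC_complex :: "complex \<Rightarrow> complex \<Rightarrow> complex"
  where "scaleC_complex c x = c * x"

instance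
  by standard
    (simp_all add: scaleC_complex_def algebra_simps norm_mult scaleR_conv_of_real)

end

definition bounded_clinear :: "('a::complex_banach \<Rightarrow> 'b::complex_banach) \<Rightarrow> bool"
  where "bounded_clinear f \<longleftrightarrow>
    bounded_linear f \<and> (\<forall>c x. f (c *\<^sub>C x) = c *\<^sub>C f x)"

definition support_functionals :: "'a::complex_banach \<Rightarrow> ('a \<Rightarrow> complex) set"
  where "support_functionals x =
    {l. bounded_clinear l \<and> l x = complex_of_real (norm x) \<and> onorm l = 1}"

definition holomorphic_map ::
  "('a::complex_banach \<Rightarrow> 'b::complex_banach) \<Rightarrow> 'a set \<Rightarrow> bool"
  where "holomorphic_map F U \<longleftrightarrow>
    open U \<and> (\<forall>z\<in>U. \<exists>L. bounded_clinear L \<and> (F has_derivative L) (at z))"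

text \<open>
  The order of differentiation is a natural number, so the space of continuous
  \<open>n\<close>-linear maps cannot be a type depending on \<open>n\<close>. Such a map is encoded as a
  function on lists of which only the values on lists of length \<open>n\<close> matter.
\<close>

definition bounded_cmultilinear ::
  "nat \<Rightarrow> ('a::complex_banach list \<Rightarrow> 'b::complex_banach) \<Rightarrow> bool"
  where "bounded_cmultilinear n L \<longleftrightarrow>
    (\<forall>ws i. length ws = n \<and> i < n \<longrightarrow> bounded_clinear (\<lambda>x. L (ws[i := x]))) \<and>
    (\<exists>C. \<forall>ws. length ws = n \<longrightarrow> norm (L ws) \<le> C * (\<Prod>w\<leftarrow>ws. norm w))"

text \<open>
  Fr\'echet differentiability at \<open>z\<close>, with derivative \<open>L\<close>, of a map \<open>G\<close> into the space of
  continuous \<open>n\<close>-linear maps with its operator norm: the last inequality, required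
  for all \<open>ws\<close>, says that the operator norm of \<open>G (z + h) - G z - L h\<close> is at most
  \<open>e * norm h\<close>. The derivative is a linear map into the \<open>n\<close>-linear maps and is identified
  with an \<open>(n + 1)\<close>-linear map, the direction of differentiation coming first.
\<close>

definition has_multilinear_derivative ::
  "nat \<Rightarrow> ('a::complex_banach \<Rightarrow> 'a list \<Rightarrow> 'b::complex_banach) \<Rightarrow> ('a list \<Rightarrow> 'b) \<Rightarrow> 'a \<Rightarrow> bool"
  where "has_multilinear_derivative n G L z \<longleftrightarrow>
    bounded_cmultilinear (Suc n) L \<and>
    (\<forall>e>0. \<exists>d>0. \<forall>h. norm h < d \<longrightarrow>
      (\<forall>ws. length ws = n \<longrightarrow>
        norm (G (z + h) ws - G z ws - L (h # ws)) \<le> e * norm h * (\<Prod>w\<leftarrow>ws. norm w)))"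

text \<open>
  \<open>frechet_deriv n F z [w1, \<dots>, wn]\<close> is \<open>D\<^sup>nF(z)(w1, \<dots>, wn)\<close>. As for
  \<^const>\<open>frechet_derivative\<close>, the value is unspecified if the derivative does not exist.
\<close>

primrec frechet_deriv ::
  "nat \<Rightarrow> ('a::complex_banach \<Rightarrow> 'b::complex_banach) \<Rightarrow> 'a \<Rightarrow> 'a list \<Rightarrow> 'b"
  where
    "frechet_deriv 0 F = (\<lambda>z ws. F z)"
  | "frechet_deriv (Suc n) F =
      (\<lambda>z. SOME L. has_multilinear_derivative n (frechet_deriv n F) L z)"

definition zero_of_order ::
  "nat \<Rightarrow> ('a::complex_banach \<Rightarrow> 'b::complex_banach) \<Rightarrow> bool"
  where "zero_of_order n f \<longleftrightarrow>
    (\<forall>j<n. \<forall>ws. length ws = j \<longrightarrow> frechet_deriv j f 0 ws = 0) \<and>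
    (\<exists>ws. length ws = n \<and> frechet_deriv n f 0 ws \<noteq> 0)"

definition schwarz_mapping :: "('a::complex_banach \<Rightarrow> 'a) \<Rightarrow> bool"
  where "schwarz_mapping f \<longleftrightarrow>
    holomorphic_map f (ball 0 1) \<and> f ` ball 0 1 \<subseteq> ball 0 1 \<and> f 0 = 0"

definition taylor_poly :: "('a::complex_banach \<Rightarrow> complex) \<Rightarrow> nat \<Rightarrow> 'a \<Rightarrow> complex"
  where "taylor_poly F s z = frechet_deriv s F 0 (replicate s z) / fact s"

definition bohr_summable ::
  "('a::complex_banach \<Rightarrow> complex) \<Rightarrow> ('a \<Rightarrow> 'a) \<Rightarrow> 'a \<Rightarrow> bool"
  where "bohr_summable F \<mu>k z \<longleftrightarrow>
    summable (\<lambda>j. cmod (taylor_poly F (j + 3) (\<mu>k z))) \<and>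
    summable (\<lambda>j. (cmod (taylor_poly F (j + 2) (\<mu>k z)))\<^sup>2)"

text \<open>
  The two infinite series start at \<open>j = 3\<close> and \<open>j = 2\<close>. Their sums are meaningful
  only under \<open>bohr_summable\<close>, which is therefore asserted wherever this is used.
\<close>

definition bohr_functional ::
  "nat \<Rightarrow> ('a::complex_banach \<Rightarrow> 'a) \<Rightarrow> ('a \<Rightarrow> 'a) \<Rightarrow> ('a \<Rightarrow> complex) \<Rightarrow> 'a \<Rightarrow> real \<Rightarrow> real"
  where "bohr_functional k \<mu>k \<mu>m F z r =
    (cmod (F (\<mu>m z)))\<^sup>2
    + cmod (frechet_deriv 1 F (\<mu>m z) [\<mu>m z])
    + 1 / fact 2 * cmod (frechet_deriv 2 F (\<mu>m z) [\<mu>m z, \<mu>m z])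
    + (\<Sum>j. cmod (taylor_poly F (j + 3) (\<mu>k z)))
    + (cmod (taylor_poly F 1 (\<mu>k z)))\<^sup>2 * r ^ k / (1 - r ^ k)
    + (1 / (1 + cmod (F 0)) + r ^ k / (1 - r ^ k))
        * (\<Sum>j. (cmod (taylor_poly F (j + 2) (\<mu>k z)))\<^sup>2)"

definition R2_equation :: "nat \<Rightarrow> real \<Rightarrow> bool"
  where "R2_equation m r \<longleftrightarrow> r ^ (3 * m) - r ^ (2 * m) - 2 * r ^ m + 1 = 0"

definition R2 :: "nat \<Rightarrow> real"
  where "R2 m = (THE r. 0 < r \<and> r < 1 \<and> R2_equation m r)"

definition R2k_equation :: "nat \<Rightarrow> nat \<Rightarrow> real \<Rightarrow> bool"
  where "R2k_equation m k r \<longleftrightarrow>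
    (1 - r ^ k) * (-1 + 2 * r ^ m + r ^ (2 * m) - r ^ (3 * m))
      + r ^ (3 * k) * (1 - r ^ m) * (1 + r ^ m)\<^sup>2 = 0"

definition R2k :: "nat \<Rightarrow> nat \<Rightarrow> real"
  where "R2k m k = (LEAST r. 0 < r \<and> R2k_equation m k r)"

definition extremal_fun :: "('a::complex_banach \<Rightarrow> complex) \<Rightarrow> real \<Rightarrow> 'a \<Rightarrow> complex"
  where "extremal_fun l a z =
    (complex_of_real a - l z) / (1 - complex_of_real a * l z)"

end

theory Submission
  imports Defs "HOL-Complex_Analysis.Complex_Analysis"
begin

text \<open>
  Restricted to the complex line through a point, a holomorphic mapping of the ball into the
  closed disc is a function \<open>f\<close> of one variable with \<open>\<bar>f\<bar> \<le> 1\<close> on the unit disc, and every term of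
  the functional is a derivative of such an \<open>f\<close> at \<open>t = \<parallel>\<mu>\<^sub>m z\<parallel>\<close> or a Taylor coefficient times a power of
  \<open>\<parallel>\<mu>\<^sub>k z\<parallel>\<close>. By the Schwarz lemma for zeros of higher order (\<open>Schwarz_mapping_bound\<close>) these radii are
  at most \<open>\<rho> = r\<^sup>m\<close> and \<open>x = r\<^sup>k\<close>.

  \<^item> The Schwarz--Pick bounds for \<open>f'\<close> and \<open>f''\<close> (\<open>Schwarz_Pick_derivatives\<close>) bound the three terms
    at \<open>\<mu>\<^sub>m z\<close> by \<open>1 - (1 - \<bar>f t\<bar>\<^sup>2) (1 - W t)\<close> with \<open>W t = t / ((1 - t) (1 - t\<^sup>2))\<close>, and
    \<open>1 - \<bar>f t\<bar>\<^sup>2 \<ge> (1 - \<bar>a\<bar>\<^sup>2) (1 - t) / (1 + t)\<close> is a form of Harnack's inequality.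
  \<^item> Carlson's sharp coefficient inequalities (\<open>Carlson_odd\<close>, \<open>Carlson_even\<close>) give back, when summed
    against \<open>x\<^sup>n\<close>, exactly the weights of the remaining terms. These terms are therefore
    together at most \<open>(1 - \<bar>a\<bar>\<^sup>2) x\<^sup>3 / (1 - x)\<close> (\<open>refined_Bohr_sum\<close>).

  The factor \<open>1 - \<bar>a\<bar>\<^sup>2\<close> is common to both parts, so the functional is at most one as soon as
  \<open>x\<^sup>3 / (1 - x) \<le> (1 - \<rho>) / (1 + \<rho>) (1 - W \<rho>)\<close>. With the denominators cleared, this says that the left-hand
  side of the equation for \<open>R\<^sub>2\<^sub>,\<^sub>m\<^sub>,\<^sub>k\<close> is nonpositive, which holds from \<open>r = 0\<close> up to its first zero.
  For the extremal functions the same upper bound and the lower bound \<open>\<bar>F (\<mu>\<^sub>m z)\<bar>\<^sup>2\<close> both tend to one,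
  because \<open>1 - \<bar>F (\<mu>\<^sub>m z)\<bar>\<^sup>2\<close> and \<open>1 - a\<^sup>2\<close> tend to zero while their factors do not depend on \<open>a\<close>.

  The reduction to one variable presupposes that a complex differentiable mapping between Banach
  spaces has Fr\'echet derivatives of every order. Norming functionals carry the one-variable Cauchy estimates
  over to such mappings (\<open>Cauchy_estimates_map\<close>), and these estimates turn the convergence of
  difference quotients into locally uniform convergence, from which the differentiability of the
  derivative follows (\<open>holomorphic_map_directional_derivative\<close>).
\<close>

section \<open>Norming functionals\<close>

text \<open>
  Homogeneity is required as an inequality only, including \<open>c = 0\<close>; this is what is checked most
  easily for infima, and equality follows.
\<close>

definition sublinear :: "('a::real_vector \<Rightarrow> real) \<Rightarrow> bool" where
  "sublinear p \<longleftrightarrow>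
    (\<forall>x y. p (x + y) \<le> p x + p y) \<and> (\<forall>c x. 0 \<le> c \<longrightarrow> p (c *\<^sub>R x) \<le> c * p x)"

lemma sublinearD:
  assumes "sublinear p"
  shows "p (x + y) \<le> p x + p y" and "0 \<le> c \<Longrightarrow> p (c *\<^sub>R x) = c * p x" and "p 0 = 0"
    and "- p (- x) \<le> p x"
proof -
  show add: "p (x + y) \<le> p x + p y" for x y
    using assms by (simp add: sublinear_def)
  have le: "0 \<le> c \<Longrightarrow> p (c *\<^sub>R x) \<le> c * p x" for c x
    using assms by (simp add: sublinear_def)
  show zero: "p 0 = 0"
    using add[of 0 0] le[of 0 0] by simp
  show "p (c *\<^sub>R x) = c * p x" if "0 \<le> c"
  proof (cases "c = 0")
    case True
    then show ?thesis by (simp add: zero)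
  next
    case False
    then have "c * p x \<le> p (c *\<^sub>R x)"
      using that le[of "1 / c" "c *\<^sub>R x"] by (simp add: field_simps)
    then show ?thesis using le[OF that, of x] by simp
  qed
  show "- p (- x) \<le> p x"
    using add[of x "- x"] zero by simp
qed

text \<open>
  A sublinear functional below \<open>p\<close> that decreases at least at the rate \<open>p a\<close> in the
  direction \<open>- a\<close>. A functional that cannot be lowered in this way is superadditive.
\<close>

definition decrease_along :: "'a::real_vector \<Rightarrow> ('a \<Rightarrow> real) \<Rightarrow> 'a \<Rightarrow> real" where
  "decrease_along a p x = (INF t\<in>{0..}. p (x + t *\<^sub>R a) - t * p a)"

lemma decrease_along_le:
  assumes "sublinear p" and "0 \<le> t"
  shows "decrease_along a p x \<le> p (x + t *\<^sub>R a) - t * p a"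
  unfolding decrease_along_def
proof (rule cINF_lower)
  have "- p (- x) \<le> p (x + t *\<^sub>R a) - t * p a" if "0 \<le> t" for t
    using sublinearD(1)[OF assms(1), of "x + t *\<^sub>R a" "- x"] sublinearD(2)[OF assms(1) that, of a]
    by simp
  then show "bdd_below ((\<lambda>t. p (x + t *\<^sub>R a) - t * p a) ` {0..})"
    by (auto intro!: bdd_belowI[of _ "- p (- x)"])
qed (use assms in simp)

lemma sublinear_decrease_along:
  assumes p: "sublinear p"
  shows "sublinear (decrease_along a p)"
proof -
  let ?q = "decrease_along a p"
  have "?q (x + y) \<le> ?q x + ?q y" for x y
  proof -
    have "?q (x + y) - (p (y + t *\<^sub>R a) - t * p a) \<le> p (x + s *\<^sub>R a) - s * p a"
      if "0 \<le> s" "0 \<le> t" for s t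
      using decrease_along_le[OF p, of "s + t" a "x + y"] that
        sublinearD(1)[OF p, of "x + s *\<^sub>R a" "y + t *\<^sub>R a"]
      by (simp add: algebra_simps)
    then have "?q (x + y) - (p (y + t *\<^sub>R a) - t * p a) \<le> ?q x" if "0 \<le> t" for t
      unfolding decrease_along_def[of a p x] by (intro cINF_greatest) (use that in auto)
    then have "?q (x + y) - ?q x \<le> p (y + t *\<^sub>R a) - t * p a" if "0 \<le> t" for t
      using that by (simp add: algebra_simps)
    then have "?q (x + y) - ?q x \<le> ?q y"
      unfolding decrease_along_def[of a p y] by (intro cINF_greatest) auto
    then show ?thesis by simp
  qed
  moreover have "?q (c *\<^sub>R x) \<le> c * ?q x" if "0 \<le> c" for c x
  proof (cases "c = 0")
    case True
    then show ?thesis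
      using decrease_along_le[OF p, of 0 a 0] sublinearD(3)[OF p] by simp
  next
    case False
    then have "0 < c" using that by simp
    have "?q (c *\<^sub>R x) / c \<le> p (x + s *\<^sub>R a) - s * p a" if "0 \<le> s" for s
      using decrease_along_le[OF p, of "c * s" a "c *\<^sub>R x"] that \<open>0 < c\<close>
        sublinearD(2)[OF p, of c "x + s *\<^sub>R a"]
      by (simp add: scaleR_add_right field_simps)
    then have "?q (c *\<^sub>R x) / c \<le> ?q x"
      unfolding decrease_along_def[of a p x] by (intro cINF_greatest) auto
    then show ?thesis using \<open>0 < c\<close> by (simp add: field_simps)
  qed
  ultimately show ?thesis by (auto simp: sublinear_def)
qed

text \<open>
  Zorn's lemma for the reversed pointwise order. The infimum of a chain is again subadditive because
  two members of the chain can be replaced by the smaller one; the values are bounded below because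
  every member \<open>q\<close> satisfies \<open>q x \<ge> - q (- x) \<ge> - p (- x)\<close>.
\<close>

lemma exists_minimal_sublinear:
  assumes p: "sublinear p"
  obtains q where "sublinear q" "\<And>x. q x \<le> p x"
    "\<And>q'. sublinear q' \<Longrightarrow> (\<And>x. q' x \<le> q x) \<Longrightarrow> q' = q"
proof -
  define A where "A = {q. sublinear q \<and> (\<forall>x. q x \<le> p x)}"
  define P :: "('a \<Rightarrow> real) \<Rightarrow> ('a \<Rightarrow> real) \<Rightarrow> bool" where "P a b \<longleftrightarrow> (\<forall>x. b x \<le> a x)" for a b
  have "\<exists>m\<in>A. \<forall>a\<in>A. P m a \<longrightarrow> a = m"
  proof (rule predicate_Zorn)
    show "partial_order_on A (relation_of P A)"
    proof (rule partial_order_on_relation_ofI)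
      show "a = b" if "P a b" "P b a" for a b
        using that unfolding P_def by (meson ext order_antisym)
    qed (auto simp: P_def intro: order_trans)
    fix C assume "C \<in> Chains (relation_of P A)"
    then have CA: "C \<subseteq> A" and ch: "\<And>a b. a \<in> C \<Longrightarrow> b \<in> C \<Longrightarrow> P a b \<or> P b a"
      unfolding Chains_def relation_of_def by auto
    show "\<exists>u\<in>A. \<forall>a\<in>C. P a u"
    proof (cases "C = {}")
      case True
      then show ?thesis using p by (auto simp: A_def)
    next
      case False
      define u where "u x = (INF q\<in>C. q x)" for x
      have low: "- p (- x) \<le> q x" if "q \<in> C" for q x
      proof -
        have "- q (- x) \<le> q x" "q (- x) \<le> p (- x)"
          using that CA sublinearD(4) by (auto simp: A_def)
        then show ?thesis by linarith
      qed
      then have ule: "u x \<le> q x" if "q \<in> C" for q x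
        unfolding u_def using that by (intro cINF_lower bdd_belowI[of _ "- p (- x)"]) auto
      have "u (x + y) \<le> u x + u y" for x y
      proof -
        have "u (x + y) - r y \<le> q x" if q: "q \<in> C" and r: "r \<in> C" for q r
        proof -
          obtain s where s: "s \<in> C" "\<And>x. s x \<le> q x" "\<And>x. s x \<le> r x"
            using ch[OF q r] q r by (auto simp: P_def)
          have "s (x + y) \<le> s x + s y"
            using s(1) CA sublinearD(1)[of s x y] unfolding A_def by blast
          then show ?thesis
            using ule[OF s(1), of "x + y"] s(2)[of x] s(3)[of y] by linarith
        qed
        then have "u (x + y) - r y \<le> u x" if "r \<in> C" for r
          unfolding u_def[of x] using that False by (intro cINF_greatest) auto
        then have "u (x + y) - u x \<le> r y" if "r \<in> C" for r
          using that by (simp add: algebra_simps)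
        then have "u (x + y) - u x \<le> u y"
          unfolding u_def[of y] using False by (intro cINF_greatest) auto
        then show ?thesis by simp
      qed
      moreover have "u (c *\<^sub>R x) \<le> c * u x" if "0 \<le> c" for c x
      proof -
        have hom: "u (c *\<^sub>R x) \<le> c * q x" if "q \<in> C" for q
          using ule[OF that, of "c *\<^sub>R x"] that CA sublinearD(2)[OF _ \<open>0 \<le> c\<close>, of q x]
          by (auto simp: A_def)
        show ?thesis
        proof (cases "c = 0")
          case True
          then show ?thesis using hom False by auto
        next
          case False
          then have "u (c *\<^sub>R x) / c \<le> q x" if "q \<in> C" for q
            using hom[OF that] \<open>0 \<le> c\<close> by (simp add: field_simps)
          then have "u (c *\<^sub>R x) / c \<le> u x"
            unfolding u_def[of x] using \<open>C \<noteq> {}\<close> by (intro cINF_greatest) auto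
          then show ?thesis using False \<open>0 \<le> c\<close> by (simp add: field_simps)
        qed
      qed
      moreover obtain q where "q \<in> C" using False by auto
      then have "u x \<le> p x" for x
        using CA by (intro order_trans[OF ule[of q x]]) (auto simp: A_def)
      ultimately have "u \<in> A" by (auto simp: A_def sublinear_def)
      then show ?thesis using ule by (auto simp: P_def)
    qed
  qed
  then obtain q where q: "q \<in> A" "\<And>a. a \<in> A \<Longrightarrow> P q a \<Longrightarrow> a = q" by blast
  show thesis
  proof (rule that[of q])
    show "q' = q" if "sublinear q'" "\<And>x. q' x \<le> q x" for q'
    proof (rule q(2))
      have "q' x \<le> p x" for x
        using q(1) by (intro order_trans[OF that(2)[of x]]) (auto simp: A_def)
      then show "q' \<in> A" using that(1) by (simp add: A_def)
    qed (use that in \<open>simp add: P_def\<close>)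
  qed (use q(1) in \<open>auto simp: A_def\<close>)
qed

text \<open>
  Lowering \<open>q\<close> along \<open>a\<close> changes nothing, so \<open>q x \<le> q (x + a) - q a\<close>.
\<close>

lemma minimal_sublinear_imp_linear:
  assumes q: "sublinear q" and min: "\<And>q'. sublinear q' \<Longrightarrow> (\<And>x. q' x \<le> q x) \<Longrightarrow> q' = q"
  shows "linear q"
proof -
  have add: "q (x + a) = q x + q a" for x a
  proof -
    have "decrease_along a q = q"
      using decrease_along_le[OF q, of 0 a] by (intro min sublinear_decrease_along[OF q]) simp
    then have "q x \<le> q (x + a) - q a"
      using decrease_along_le[OF q, of 1 a x] by simp
    then show ?thesis using sublinearD(1)[OF q, of x a] by simp
  qed
  have minus: "q (- x) = - q x" for x
    using add[of x "- x"] sublinearD(3)[OF q] by simp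
  have "q (c *\<^sub>R x) = c * q x" for c x
  proof (cases "0 \<le> c")
    case False
    then have "q ((- c) *\<^sub>R x) = - c * q x"
      by (intro sublinearD(2)[OF q]) simp
    then show ?thesis using minus[of "c *\<^sub>R x"] by simp
  qed (rule sublinearD(2)[OF q])
  then show ?thesis using add by (intro linearI) auto
qed

lemma scaleC_scaleR: "c *\<^sub>C (t *\<^sub>R x) = t *\<^sub>R (c *\<^sub>C x)" for x :: "'a::complex_banach"
  by (metis mult.commute scaleC_of_real scaleC_scaleC)

lemma scaleR_eq_scaleC: "t *\<^sub>R x = complex_of_real t *\<^sub>C x" for x :: "'a::complex_banach"
  by (simp add: scaleC_of_real)

lemma scaleC_one [simp]: "1 *\<^sub>C x = x" for x :: "'a::complex_banach"
  using scaleC_of_real[of 1 x] by simp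

lemma scaleC_zero_left [simp]: "0 *\<^sub>C x = 0" for x :: "'a::complex_banach"
  using scaleC_of_real[of 0 x] by simp

lemma bounded_linear_scaleC_right: "bounded_linear (\<lambda>x::'a::complex_banach. c *\<^sub>C x)"
  by (rule bounded_linear_intro[of _ "cmod c"])
    (simp_all add: scaleC_add_right scaleC_scaleR norm_scaleC mult.commute)

lemma bounded_linear_scaleC_left: "bounded_linear (\<lambda>c. c *\<^sub>C (x::'a::complex_banach))"
proof (rule bounded_linear_intro[of _ "norm x"])
  show "(r *\<^sub>R c) *\<^sub>C x = r *\<^sub>R (c *\<^sub>C x)" for r c
    by (metis scaleC_of_real scaleC_scaleC scaleR_conv_of_real)
qed (simp_all add: scaleC_add_left norm_scaleC)

lemma bounded_clinearD:
  assumes "bounded_clinear f"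
  shows "bounded_linear f" and "f (c *\<^sub>C x) = c *\<^sub>C f x"
  using assms by (auto simp: bounded_clinear_def)

text \<open>
  A form of the Hahn--Banach theorem. The norm is first lowered along \<open>y\<close>, which forces the value at
  \<open>- y\<close> down to \<open>- norm y\<close>; a minimal sublinear functional below it is real linear and attains
  \<open>norm y\<close> at \<open>y\<close>. It is the real part of the complex functional sought.
\<close>

theorem norming_functional_exists:
  fixes y :: "'a::complex_banach"
  obtains l :: "'a \<Rightarrow> complex" where
    "bounded_clinear l" "l y = complex_of_real (norm y)" "\<And>x. cmod (l x) \<le> norm x"
proof -
  have norm_sub: "sublinear (norm :: 'a \<Rightarrow> real)"
    by (simp add: sublinear_def norm_triangle_ineq)
  define p where "p = decrease_along y norm"
  obtain q where q: "sublinear q" "\<And>x. q x \<le> p x"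
    "\<And>q'. sublinear q' \<Longrightarrow> (\<And>x. q' x \<le> q x) \<Longrightarrow> q' = q"
    using exists_minimal_sublinear[OF sublinear_decrease_along[OF norm_sub, of y]]
    unfolding p_def by metis
  have lin: "linear q"
    by (rule minimal_sublinear_imp_linear[OF q(1,3)])
  have q_add: "q (x + x') = q x + q x'" and q_scale: "q (t *\<^sub>R x) = t * q x" for x x' t
    using linear_add[OF lin] linear_cmul[OF lin] by auto
  have q_le: "q x \<le> norm x" for x
    using q(2)[of x] decrease_along_le[OF norm_sub, of 0 y x] by (simp add: p_def)
  \<comment> \<open>at \<open>- y\<close> the lowered norm is at most \<open>norm (- y + y) - norm y\<close>\<close>
  have "q y \<ge> norm y"
    using q(2)[of "- y"] decrease_along_le[OF norm_sub, of 1 y "- y"] q_scale[of "-1" y]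
    by (simp add: p_def)
  then have qy: "q y = norm y" using q_le[of y] by simp
  define l where "l x = Complex (q x) (- q (\<i> *\<^sub>C x))" for x
  have l_add: "l (x + x') = l x + l x'" for x x'
    by (simp add: l_def scaleC_add_right q_add complex_eq_iff)
  have l_scale: "l (c *\<^sub>C x) = c * l x" for c x
  proof -
    have *: "q (c *\<^sub>C x) = Re c * q x + Im c * q (\<i> *\<^sub>C x)" for c x
    proof -
      have "c *\<^sub>C x = (complex_of_real (Re c) + complex_of_real (Im c) * \<i>) *\<^sub>C x"
        by (rule arg_cong[where f = "\<lambda>c. c *\<^sub>C x"]) (simp add: complex_eq_iff)
      also have "\<dots> = Re c *\<^sub>R x + Im c *\<^sub>R (\<i> *\<^sub>C x)"
        by (simp only: scaleC_add_left scaleC_of_real flip: scaleC_scaleC)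
      finally have "c *\<^sub>C x = Re c *\<^sub>R x + Im c *\<^sub>R (\<i> *\<^sub>C x)" .
      then show ?thesis by (simp add: q_add q_scale)
    qed
    show ?thesis
      using *[of c x] *[of "\<i> * c" x] by (simp add: l_def scaleC_scaleC complex_eq_iff)
  qed
  have l_le: "cmod (l x) \<le> norm x" for x
  proof (cases "l x = 0")
    case False
    \<comment> \<open>a rotation that makes the value of \<open>l\<close> real, where it is bounded by \<open>q\<close>\<close>
    define u where "u = cnj (l x) / cmod (l x)"
    have u1: "cmod u = 1" using False by (simp add: u_def norm_divide)
    have "u * l x = complex_of_real (cmod (l x))"
      using False complex_norm_square[of "l x"] unfolding u_def
      by (simp add: nonzero_divide_eq_eq power2_eq_square mult.commute)
    then have "cmod (l x) = Re (l (u *\<^sub>C x))" by (simp add: l_scale)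
    also have "\<dots> = q (u *\<^sub>C x)" by (simp add: l_def)
    also have "\<dots> \<le> norm x" using q_le[of "u *\<^sub>C x"] by (simp add: norm_scaleC u1)
    finally show ?thesis .
  qed simp
  show thesis
  proof (rule that)
    have "l (r *\<^sub>R x) = r *\<^sub>R l x" for r x
      using l_scale[of "of_real r" x] by (simp add: scaleC_of_real scaleR_conv_of_real)
    then have "bounded_linear l"
      by (intro bounded_linear_intro[of _ 1]) (auto simp: l_add l_le)
    then show "bounded_clinear l"
      by (simp add: bounded_clinear_def l_scale scaleC_complex_def)
    have "cmod (l y) \<le> Re (l y)" using l_le[of y] by (simp add: l_def qy)
    then have "Im (l y) = 0"
      using power_mono[of "cmod (l y)" "Re (l y)" 2] by (simp add: cmod_power2)
    then show "l y = complex_of_real (norm y)"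
      using qy by (simp add: l_def complex_eq_iff)
  qed (rule l_le)
qed

section \<open>Cauchy estimates and higher derivatives of holomorphic mappings\<close>

lemma bounded_clinear_add:
  "bounded_clinear f \<Longrightarrow> f (x + y) = f x + f y"
  by (simp add: bounded_clinear_def bounded_linear.linear linear_add)

lemma bounded_clinear_diff:
  "bounded_clinear f \<Longrightarrow> f (x - y) = f x - f y"
  by (simp add: bounded_clinear_def bounded_linear.linear linear_diff)

lemma bounded_clinear_scaleR:
  "bounded_clinear f \<Longrightarrow> f (t *\<^sub>R x) = t *\<^sub>R f x"
  by (simp add: bounded_clinear_def bounded_linear.linear linear_cmul)

lemma bounded_clinearI:
  assumes "\<And>x y. f (x + y) = f x + f y" "\<And>c x. f (c *\<^sub>C x) = c *\<^sub>C f x"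
    and "\<And>x. norm (f x) \<le> K * norm x"
  shows "bounded_clinear f"
proof -
  have "f (t *\<^sub>R x) = t *\<^sub>R f x" for t x
    by (simp add: scaleR_eq_scaleC assms(2))
  then have "bounded_linear f"
    by (intro bounded_linear_intro[of _ K]) (use assms in \<open>auto simp: mult.commute\<close>)
  then show ?thesis using assms(2) by (simp add: bounded_clinear_def)
qed

lemma norm_le_of_functionals:
  fixes y :: "'a::complex_banach"
  assumes "\<And>l. bounded_clinear l \<Longrightarrow> (\<And>x. cmod (l x) \<le> norm x) \<Longrightarrow> cmod (l y) \<le> K"
  shows "norm y \<le> K"
proof -
  obtain l :: "'a \<Rightarrow> complex" where "bounded_clinear l" "l y = complex_of_real (norm y)"
    "\<And>x. cmod (l x) \<le> norm x"
    using norming_functional_exists by blast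
  then show ?thesis using assms[of l] by simp
qed

lemma holomorphic_map_derivative:
  assumes "holomorphic_map g U" "z \<in> U"
  shows "(g has_derivative frechet_derivative g (at z)) (at z)"
    and "bounded_clinear (frechet_derivative g (at z))"
proof -
  obtain L where L: "bounded_clinear L" "(g has_derivative L) (at z)"
    using assms by (auto simp: holomorphic_map_def)
  then have "frechet_derivative g (at z) = L"
    by (metis frechet_derivative_at)
  then show "(g has_derivative frechet_derivative g (at z)) (at z)"
    and "bounded_clinear (frechet_derivative g (at z))"
    using L by auto
qed

lemma holomorphic_map_continuous_at:
  assumes "holomorphic_map g U" "z \<in> U"
  shows "isCont g z"
  using holomorphic_map_derivative(1)[OF assms] has_derivative_continuous by blast

lemma has_field_derivative_along_line:
  assumes g: "(g has_derivative L) (at (z + \<zeta> *\<^sub>C v))" and L: "bounded_clinear L"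
    and l: "bounded_clinear l"
  shows "((\<lambda>\<zeta>. l (g (z + \<zeta> *\<^sub>C v))) has_field_derivative l (L v)) (at \<zeta>)"
proof -
  have 1: "((\<lambda>\<zeta>. z + \<zeta> *\<^sub>C v) has_derivative (\<lambda>h. h *\<^sub>C v)) (at \<zeta>)"
    using bounded_linear_imp_has_derivative[OF bounded_linear_scaleC_left]
    by (auto intro!: derivative_eq_intros)
  have "((\<lambda>\<zeta>. g (z + \<zeta> *\<^sub>C v)) has_derivative (\<lambda>h. L (h *\<^sub>C v))) (at \<zeta>)"
    using diff_chain_at[OF 1 g] by (simp add: o_def)
  then have "((\<lambda>\<zeta>. l (g (z + \<zeta> *\<^sub>C v))) has_derivative (\<lambda>h. l (L (h *\<^sub>C v)))) (at \<zeta>)"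
    by (rule bounded_linear.has_derivative[OF bounded_clinearD(1)[OF l]])
  moreover have "(\<lambda>h. l (L (h *\<^sub>C v))) = (*) (l (L v))"
    by (rule ext) (simp add: bounded_clinearD(2)[OF L] bounded_clinearD(2)[OF l]
        scaleC_complex_def mult.commute)
  ultimately show ?thesis
    by (simp add: has_field_derivative_def)
qed

lemma open_line_preimage:
  "open U \<Longrightarrow> open {\<zeta>. z + \<zeta> *\<^sub>C (v::'a::complex_banach) \<in> U}"
proof -
  assume "open U"
  moreover have "continuous_on UNIV (\<lambda>\<zeta>. z + \<zeta> *\<^sub>C v)"
    by (intro continuous_on_add continuous_on_const
        bounded_linear.continuous_on[OF bounded_linear_scaleC_left continuous_on_id])
  ultimately have "open ((\<lambda>\<zeta>. z + \<zeta> *\<^sub>C v) -` U)"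
    by (rule open_vimage)
  then show ?thesis by (simp add: vimage_def)
qed

lemma holomorphic_on_line:
  assumes g: "holomorphic_map g U" and l: "bounded_clinear l"
  shows "(\<lambda>\<zeta>. l (g (z + \<zeta> *\<^sub>C v))) holomorphic_on {\<zeta>. z + \<zeta> *\<^sub>C v \<in> U}"
proof -
  have "open {\<zeta>. z + \<zeta> *\<^sub>C v \<in> U}"
    using g by (intro open_line_preimage) (simp add: holomorphic_map_def)
  then show ?thesis
    using has_field_derivative_along_line[OF holomorphic_map_derivative[OF g] l]
    by (auto simp: holomorphic_on_open)
qed

text \<open>
  Taylor's formula with the second derivative bounded on the disc of half the radius, where Cauchy's
  inequality applies on circles of radius \<open>R / 2\<close>.
\<close>

lemma scalar_Cauchy_remainder:
  fixes \<phi> :: "complex \<Rightarrow> complex"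
  assumes hol: "\<phi> holomorphic_on S" and S: "open S" "cball 0 R \<subseteq> S" and "0 < R"
    and M: "\<And>\<zeta>. \<zeta> \<in> cball 0 R \<Longrightarrow> cmod (\<phi> \<zeta>) \<le> M" and "cmod \<zeta> \<le> R / 2"
  shows "cmod (\<phi> \<zeta> - \<phi> 0 - \<zeta> * deriv \<phi> 0) \<le> 8 * M / R\<^sup>2 * (cmod \<zeta>)\<^sup>2"
proof -
  have bound: "cmod ((deriv ^^ 2) \<phi> \<xi>) \<le> 8 * M / R\<^sup>2" if \<xi>: "\<xi> \<in> cball 0 (R / 2)" for \<xi>
  proof -
    have sub: "cball \<xi> (R / 2) \<subseteq> cball 0 R"
    proof
      fix x assume "x \<in> cball \<xi> (R / 2)"
      then show "x \<in> cball 0 R"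
        using \<xi> dist_triangle[of 0 x \<xi>] by simp
    qed
    have "cmod ((deriv ^^ 2) \<phi> \<xi>) \<le> fact 2 * M / (R / 2)\<^sup>2"
    proof (rule Cauchy_inequality)
      have *: "\<phi> holomorphic_on cball \<xi> (R / 2)"
        using hol by (rule holomorphic_on_subset) (use sub S in blast)
      then show "\<phi> holomorphic_on ball \<xi> (R / 2)"
        by (rule holomorphic_on_subset) auto
      show "continuous_on (cball \<xi> (R / 2)) \<phi>"
        using * by (rule holomorphic_on_imp_continuous_on)
      show "cmod (\<phi> x) \<le> M" if "cmod (\<xi> - x) = R / 2" for x
        using that sub by (intro M) (auto simp: dist_norm)
    qed (use \<open>0 < R\<close> in simp)
    then show ?thesis by (simp add: power_divide)
  qed
  have "cmod ((deriv ^^ 0) \<phi> \<zeta> - (\<Sum>i\<le>1. (deriv ^^ i) \<phi> 0 * (\<zeta> - 0) ^ i / fact i))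
      \<le> 8 * M / R\<^sup>2 * cmod (\<zeta> - 0) ^ Suc 1 / fact 1"
  proof (rule complex_Taylor[where S = "cball 0 (R / 2)"])
    show "((deriv ^^ i) \<phi> has_field_derivative (deriv ^^ Suc i) \<phi> x) (at x within cball 0 (R / 2))"
      if "x \<in> cball 0 (R / 2)" for i x
    proof -
      have "x \<in> S" using that S(2) \<open>0 < R\<close> by auto
      have "(deriv ^^ i) \<phi> holomorphic_on S"
        by (rule holomorphic_higher_deriv[OF hol S(1)])
      then have "((deriv ^^ i) \<phi> has_field_derivative deriv ((deriv ^^ i) \<phi>) x) (at x)"
        using S(1) \<open>x \<in> S\<close> by (rule holomorphic_derivI)
      then show ?thesis
        by (simp add: has_field_derivative_at_within)
    qed
    show "cmod ((deriv ^^ Suc 1) \<phi> x) \<le> 8 * M / R\<^sup>2" if "x \<in> cball 0 (R / 2)" for x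
      using bound[OF that] by (simp add: numeral_2_eq_2)
  qed (use assms in auto)
  then show ?thesis by (simp add: power2_eq_square algebra_simps)
qed

text \<open>
  Every functional of norm at most one turns \<open>g\<close> on the complex line in the direction of \<open>h\<close> into a
  scalar function bounded by \<open>M\<close>. The resulting bounds do not depend on the functional, so they
  hold for the norm.
\<close>

theorem Cauchy_estimates_map:
  fixes g :: "'a::complex_banach \<Rightarrow> 'b::complex_banach"
  assumes g: "holomorphic_map g U" and sub: "cball z R \<subseteq> U" and R: "0 < R"
    and M: "\<And>y. y \<in> cball z R \<Longrightarrow> norm (g y) \<le> M"
  shows "norm (frechet_derivative g (at z) h) \<le> M / R * norm h"
    and "norm h \<le> R / 2 \<Longrightarrow>
      norm (g (z + h) - g z - frechet_derivative g (at z) h) \<le> 8 * M / R\<^sup>2 * (norm h)\<^sup>2"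
proof -
  define L where "L = frechet_derivative g (at z)"
  have zU: "z \<in> U" using sub R by auto
  have L: "(g has_derivative L) (at z)" "bounded_clinear L"
    using holomorphic_map_derivative[OF g zU] by (auto simp: L_def)
  define v where "v = sgn h"
  have v: "norm v \<le> 1" by (simp add: v_def norm_sgn)
  have h: "h = complex_of_real (norm h) *\<^sub>C v"
    by (cases "h = 0") (simp_all add: v_def scaleC_of_real sgn_div_norm)
  define S where "S = {\<zeta>. z + \<zeta> *\<^sub>C v \<in> U}"
  have opS: "open S"
    using g unfolding S_def by (intro open_line_preimage) (simp add: holomorphic_map_def)
  have in_ball: "z + \<zeta> *\<^sub>C v \<in> cball z R" if "\<zeta> \<in> cball 0 R" for \<zeta>
    using that v R mult_mono[of "cmod \<zeta>" R "norm v" 1] by (simp add: dist_norm norm_scaleC)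
  then have subS: "cball 0 R \<subseteq> S" using sub by (auto simp: S_def)
  have along: "cmod (l (L v)) \<le> M / R"
    "norm h \<le> R / 2 \<Longrightarrow> cmod (l (g (z + h) - g z - L h)) \<le> 8 * M / R\<^sup>2 * (norm h)\<^sup>2"
    if l: "bounded_clinear l" and l1: "\<And>x. cmod (l x) \<le> norm x" for l
  proof -
    define \<phi> where "\<phi> \<zeta> = l (g (z + \<zeta> *\<^sub>C v))" for \<zeta>
    have hol: "\<phi> holomorphic_on S"
      unfolding \<phi>_def S_def by (rule holomorphic_on_line[OF g l])
    have \<phi>M: "cmod (\<phi> \<zeta>) \<le> M" if "\<zeta> \<in> cball 0 R" for \<zeta>
      using l1 M[OF in_ball[OF that]] by (auto simp: \<phi>_def intro: order_trans)
    have d: "deriv \<phi> 0 = l (L v)"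
      using has_field_derivative_along_line[of g L z 0 v l] L l
      unfolding \<phi>_def by (intro DERIV_imp_deriv) simp
    have "cmod ((deriv ^^ 1) \<phi> 0) \<le> fact 1 * M / R ^ 1"
    proof (rule Cauchy_inequality)
      show "\<phi> holomorphic_on ball 0 R"
        using hol by (rule holomorphic_on_subset) (use subS in auto)
      show "continuous_on (cball 0 R) \<phi>"
        using holomorphic_on_subset[OF hol subS] by (rule holomorphic_on_imp_continuous_on)
    qed (use R in \<open>auto intro!: \<phi>M simp: dist_norm\<close>)
    then show "cmod (l (L v)) \<le> M / R" by (simp add: d)
    assume hR: "norm h \<le> R / 2"
    have "cmod (\<phi> (norm h) - \<phi> 0 - norm h * deriv \<phi> 0) \<le> 8 * M / R\<^sup>2 * (cmod (norm h))\<^sup>2"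
      by (rule scalar_Cauchy_remainder[OF hol opS subS R \<phi>M]) (use hR in auto)
    moreover have "l (g (z + h) - g z - L h) = \<phi> (norm h) - \<phi> 0 - norm h * deriv \<phi> 0"
    proof -
      have "l (L h) = norm h * l (L v)"
        by (subst h) (simp add: bounded_clinearD(2)[OF L(2)] bounded_clinearD(2)[OF l] scaleC_complex_def)
      then show ?thesis
        by (simp add: \<phi>_def d bounded_clinear_diff[OF l] flip: h)
    qed
    ultimately show "cmod (l (g (z + h) - g z - L h)) \<le> 8 * M / R\<^sup>2 * (norm h)\<^sup>2"
      by simp
  qed
  have "norm (L v) \<le> M / R"
    by (rule norm_le_of_functionals) (rule along(1))
  moreover have "norm (L h) = norm h * norm (L v)"
    by (subst h) (simp add: bounded_clinearD(2)[OF L(2)] norm_scaleC)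
  ultimately show "norm (L h) \<le> M / R * norm h"
    using mult_left_mono[of "norm (L v)" "M / R" "norm h"] by (simp add: mult.commute)
  show "norm (g (z + h) - g z - L h) \<le> 8 * M / R\<^sup>2 * (norm h)\<^sup>2" if "norm h \<le> R / 2"
    by (rule norm_le_of_functionals) (rule along(2)[OF _ _ that])
qed

lemma holomorphic_map_locally_bounded:
  assumes g: "holomorphic_map g U" and z: "z \<in> U"
  obtains R M where "0 < R" "0 \<le> M" "cball z R \<subseteq> U" "\<And>y. y \<in> cball z R \<Longrightarrow> norm (g y) \<le> M"
proof -
  obtain e where e: "0 < e" "ball z e \<subseteq> U"
    using g z unfolding holomorphic_map_def by (meson openE)
  obtain d where d: "0 < d" "\<And>y. dist y z < d \<Longrightarrow> dist (g y) (g z) < 1"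
    using holomorphic_map_continuous_at[OF g z] unfolding continuous_at_eps_delta
    by (metis zero_less_one)
  show thesis
  proof (rule that[of "min e d / 2" "norm (g z) + 1"])
    show "cball z (min e d / 2) \<subseteq> U"
      using e d(1) by (intro order_trans[OF _ e(2)]) auto
    show "norm (g y) \<le> norm (g z) + 1" if "y \<in> cball z (min e d / 2)" for y
    proof -
      have "dist z y \<le> min e d / 2" using that by simp
      then have "dist y z < d" using e(1) d(1) by (simp add: dist_commute)
      then have "norm (g y - g z) < 1" using d(2) by (simp add: dist_norm)
      then show ?thesis using norm_triangle_ineq2[of "g y" "g z"] by linarith
    qed
  qed (use e d in \<open>auto simp: add_nonneg_pos\<close>)
qed

lemma has_derivative_of_quadratic_remainder:
  assumes "bounded_linear B" and "0 < \<delta>"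
    and rem: "\<And>k. norm k \<le> \<delta> \<Longrightarrow> norm (f (z + k) - f z - B k) \<le> C * (norm k)\<^sup>2"
  shows "(f has_derivative B) (at z)"
  unfolding has_derivative_at_alt
proof (intro conjI allI impI)
  fix e :: real assume "0 < e"
  define d where "d = min \<delta> (e / (\<bar>C\<bar> + 1))"
  have "norm (f y - f z - B (y - z)) \<le> e * norm (y - z)" if "norm (y - z) < d" for y
  proof -
    have "norm (f y - f z - B (y - z)) \<le> C * norm (y - z) * norm (y - z)"
      using rem[of "y - z"] that by (simp add: d_def power2_eq_square mult.assoc)
    also have "C * norm (y - z) \<le> (\<bar>C\<bar> + 1) * norm (y - z)"
      by (intro mult_right_mono) auto
    also have "\<dots> \<le> e"
      using that by (simp add: d_def field_simps)
    finally show ?thesis by (simp add: mult_right_mono)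
  qed
  then show "\<exists>d>0. \<forall>y. norm (y - z) < d \<longrightarrow> norm (f y - f z - B (y - z)) \<le> e * norm (y - z)"
    using \<open>0 < e\<close> \<open>0 < \<delta>\<close> by (intro exI[of _ d]) (auto simp: d_def)
qed (rule assms(1))

lemma holomorphic_map_diff:
  assumes f: "holomorphic_map f U" and g: "holomorphic_map g U"
  shows "holomorphic_map (\<lambda>z. f z - g z) U"
    and "z \<in> U \<Longrightarrow> frechet_derivative (\<lambda>z. f z - g z) (at z) h
      = frechet_derivative f (at z) h - frechet_derivative g (at z) h"
proof -
  have *: "((\<lambda>z. f z - g z) has_derivative
      (\<lambda>h. frechet_derivative f (at z) h - frechet_derivative g (at z) h)) (at z)"
    "bounded_clinear (\<lambda>h. frechet_derivative f (at z) h - frechet_derivative g (at z) h)"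
    if "z \<in> U" for z
  proof -
    note df = holomorphic_map_derivative[OF f that] and dg = holomorphic_map_derivative[OF g that]
    show "((\<lambda>z. f z - g z) has_derivative
        (\<lambda>h. frechet_derivative f (at z) h - frechet_derivative g (at z) h)) (at z)"
      by (rule has_derivative_diff[OF df(1) dg(1)])
    have "c *\<^sub>C (x - y) = c *\<^sub>C x - c *\<^sub>C y" for c and x y :: 'b
      using scaleC_add_right[of c "x - y" y] by (simp add: algebra_simps)
    then show "bounded_clinear
        (\<lambda>h. frechet_derivative f (at z) h - frechet_derivative g (at z) h)"
      unfolding bounded_clinear_def
      using bounded_linear_sub[OF bounded_clinearD(1)[OF df(2)] bounded_clinearD(1)[OF dg(2)]]
      by (simp add: bounded_clinearD(2)[OF df(2)] bounded_clinearD(2)[OF dg(2)])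
  qed
  show "holomorphic_map (\<lambda>z. f z - g z) U"
    using * f unfolding holomorphic_map_def by blast
  show "frechet_derivative (\<lambda>z. f z - g z) (at z) h
      = frechet_derivative f (at z) h - frechet_derivative g (at z) h" if "z \<in> U"
    using frechet_derivative_at[OF *(1)[OF that]] by (simp add: fun_eq_iff)
qed

lemma holomorphic_map_translate:
  assumes g: "holomorphic_map g U" and "open V" and sub: "\<And>x. x \<in> V \<Longrightarrow> x + a \<in> U"
  shows "holomorphic_map (\<lambda>x. g (x + a)) V"
proof -
  have "((\<lambda>x. g (x + a)) has_derivative frechet_derivative g (at (x + a))) (at x)" if "x \<in> V" for x
  proof -
    have "((\<lambda>x. x + a) has_derivative (\<lambda>h. h)) (at x)"
      by (auto intro!: derivative_eq_intros)
    from diff_chain_at[OF this holomorphic_map_derivative(1)[OF g sub[OF that]]]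
    show ?thesis by (simp add: o_def)
  qed
  moreover have "bounded_clinear (frechet_derivative g (at (x + a)))" if "x \<in> V" for x
    by (rule holomorphic_map_derivative(2)[OF g sub[OF that]])
  ultimately show ?thesis
    using \<open>open V\<close> unfolding holomorphic_map_def by blast
qed

lemma holomorphic_map_scaleR:
  assumes g: "holomorphic_map g U"
  shows "holomorphic_map (\<lambda>x. t *\<^sub>R g x) U"
proof -
  have "((\<lambda>x. t *\<^sub>R g x) has_derivative (\<lambda>h. t *\<^sub>R frechet_derivative g (at x) h)) (at x)"
    "bounded_clinear (\<lambda>h. t *\<^sub>R frechet_derivative g (at x) h)" if "x \<in> U" for x
  proof -
    note dg = holomorphic_map_derivative[OF g that]
    show "((\<lambda>x. t *\<^sub>R g x) has_derivative (\<lambda>h. t *\<^sub>R frechet_derivative g (at x) h)) (at x)"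
      by (rule has_derivative_scaleR_right[OF dg(1)])
    show "bounded_clinear (\<lambda>h. t *\<^sub>R frechet_derivative g (at x) h)"
      unfolding bounded_clinear_def
      using bounded_linear_const_scaleR[OF bounded_clinearD(1)[OF dg(2)]]
      by (simp add: bounded_clinearD(2)[OF dg(2)] scaleC_scaleR)
  qed
  then show ?thesis using g unfolding holomorphic_map_def by blast
qed

lemma holomorphic_map_subset:
  "holomorphic_map g U \<Longrightarrow> open V \<Longrightarrow> V \<subseteq> U \<Longrightarrow> holomorphic_map g V"
  unfolding holomorphic_map_def by blast

text \<open>
  The difference quotients \<open>q n\<close> in the direction \<open>h\<close> are holomorphic and, by the remainder
  estimate, converge uniformly on \<open>V\<close> to the directional derivative. The Cauchy estimate for
  \<open>q n - q m\<close> makes the derivatives of \<open>q n\<close> at \<open>z\<close> converge to some \<open>B\<close>, and the remainder estimate for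
  \<open>q n\<close>, whose constant does not depend on \<open>n\<close>, survives the limit: \<open>B\<close> is the derivative of the
  directional derivative.
\<close>

theorem holomorphic_map_directional_derivative:
  fixes g :: "'a::complex_banach \<Rightarrow> 'b::complex_banach"
  assumes g: "holomorphic_map g U"
  shows "holomorphic_map (\<lambda>z. frechet_derivative g (at z) h) U"
  unfolding holomorphic_map_def
proof (intro conjI ballI)
  show "open U" using g by (simp add: holomorphic_map_def)
  fix z assume "z \<in> U"
  then obtain R3 M where "0 < R3" "0 \<le> M" "cball z R3 \<subseteq> U"
    and M3: "\<And>y. y \<in> cball z R3 \<Longrightarrow> norm (g y) \<le> M"
    using holomorphic_map_locally_bounded[OF g] by metis
  define R where "R = R3 / 3"
  have R: "0 < R" "R3 = 3 * R" using \<open>0 < R3\<close> by (auto simp: R_def)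
  define D where "D y = frechet_derivative g (at y)" for y
  define V where "V = ball z (2 * R)"
  have "open V" "z \<in> V" and cV: "cball z R \<subseteq> V" using R by (auto simp: V_def)
  have near: "cball x R \<subseteq> cball z (3 * R)" if "x \<in> V" for x
  proof
    fix y assume "y \<in> cball x R"
    then show "y \<in> cball z (3 * R)"
      using that dist_triangle[of z y x] by (simp add: V_def)
  qed
  have VU: "V \<subseteq> U" using near \<open>cball z R3 \<subseteq> U\<close> R centre_in_cball[of _ R] by fastforce
  have cU: "cball x R \<subseteq> U" and cM: "\<And>y. y \<in> cball x R \<Longrightarrow> norm (g y) \<le> M" if "x \<in> V" for x
    using near[OF that] \<open>cball z R3 \<subseteq> U\<close> M3 R(2) by auto
  \<comment> \<open>the increments \<open>t n *\<^sub>R h\<close> stay below \<open>R / 2\<close>, as the remainder estimate requires\<close>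
  define t where "t n = R / (2 * (1 + norm h)) / real (Suc n)" for n
  have t_pos: "0 < t n" for n
    using R(1) by (simp add: t_def add_pos_nonneg)
  have t_h: "norm (t n *\<^sub>R h) \<le> R / 2" for n
  proof -
    have "norm (t n *\<^sub>R h) = R / 2 * (norm h / ((1 + norm h) * real (Suc n)))"
      using R(1) by (simp add: t_def)
    also have "\<dots> \<le> R / 2 * 1"
    proof (intro mult_left_mono)
      have "1 + norm h \<le> (1 + norm h) * real (Suc n)"
        using mult_left_mono[of 1 "real (Suc n)" "1 + norm h"] by simp
      then show "norm h / ((1 + norm h) * real (Suc n)) \<le> 1"
        using norm_ge_zero[of h] by (subst divide_le_eq_1_pos) linarith+
    qed (use R in simp)
    finally show ?thesis by simp
  qed
  have t_lim: "t \<longlonglongrightarrow> 0"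
    unfolding t_def by (rule LIMSEQ_Suc) (rule lim_const_over_n)
  define q where "q n x = (1 / t n) *\<^sub>R (g (x + t n *\<^sub>R h) - g x)" for n x
  have q_hol: "holomorphic_map (q n) V" for n
  proof -
    have "x + t n *\<^sub>R h \<in> U" if "x \<in> V" for x
      using t_h[of n] R(1) by (intro subsetD[OF cU[OF that]]) (simp add: dist_norm)
    then show ?thesis
      unfolding q_def
      by (intro holomorphic_map_scaleR holomorphic_map_diff(1) holomorphic_map_translate[OF g]
          holomorphic_map_subset[OF g] \<open>open V\<close> VU)
  qed
  define K where "K = 8 * M / R\<^sup>2 * (norm h)\<^sup>2"
  have "0 \<le> K" using \<open>0 \<le> M\<close> by (simp add: K_def)
  have q_near: "norm (q n x - D x h) \<le> K * t n" if "x \<in> V" for n x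
  proof -
    have "bounded_clinear (D x)"
      unfolding D_def using that VU by (intro holomorphic_map_derivative(2)[OF g]) auto
    then have "q n x - D x h = (1 / t n) *\<^sub>R (g (x + t n *\<^sub>R h) - g x - D x (t n *\<^sub>R h))"
      using t_pos[of n] by (simp add: q_def bounded_clinear_scaleR scaleR_diff_right)
    moreover have "norm (g (x + t n *\<^sub>R h) - g x - D x (t n *\<^sub>R h))
        \<le> 8 * M / R\<^sup>2 * (norm (t n *\<^sub>R h))\<^sup>2"
      unfolding D_def
      by (rule Cauchy_estimates_map(2)[OF g cU[OF that] R(1) cM[OF that] t_h])
    moreover have "8 * M / R\<^sup>2 * (norm (t n *\<^sub>R h))\<^sup>2 = K * t n * t n"
      by (simp add: K_def power_mult_distrib power2_eq_square)
    ultimately show ?thesis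
      using t_pos[of n] by (simp add: divide_le_eq)
  qed
  define M' where "M' = M / R * norm h + K * t 0"
  have t_le: "t n \<le> t 0" for n
    unfolding t_def using R(1) by (intro divide_left_mono) (auto simp: add_pos_nonneg)
  have q_bound: "norm (q n x) \<le> M'" if "x \<in> V" for n x
  proof -
    have "norm (D x h) \<le> M / R * norm h"
      unfolding D_def by (rule Cauchy_estimates_map(1)[OF g cU[OF that] R(1) cM[OF that]])
    moreover have "norm (q n x) \<le> norm (q n x - D x h) + norm (D x h)"
      using norm_triangle_ineq[of "q n x - D x h" "D x h"] by simp
    moreover have "K * t n \<le> K * t 0"
      using t_le \<open>0 \<le> K\<close> by (rule mult_left_mono)
    ultimately show ?thesis
      using q_near[OF that, of n] by (simp add: M'_def)
  qed
  define B' where "B' n = frechet_derivative (q n) (at z)" for n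
  have B'_lin: "bounded_clinear (B' n)" for n
    unfolding B'_def by (rule holomorphic_map_derivative(2)[OF q_hol \<open>z \<in> V\<close>])
  have B'_diff: "norm (B' n k - B' m k) \<le> K * norm k / R * (t n + t m)" for n m k
  proof -
    have "norm (frechet_derivative (\<lambda>x. q n x - q m x) (at z) k) \<le> (K * (t n + t m)) / R * norm k"
    proof (rule Cauchy_estimates_map(1)[OF holomorphic_map_diff(1)[OF q_hol q_hol] cV R(1)])
      fix y assume "y \<in> cball z R"
      then have "y \<in> V" using cV by auto
      then show "norm (q n y - q m y) \<le> K * (t n + t m)"
        using norm_triangle_ineq4[of "q n y - D y h" "q m y - D y h"] q_near[of y n] q_near[of y m]
        by (simp add: algebra_simps)
    qed
    then show ?thesis
      by (simp add: holomorphic_map_diff(2)[OF q_hol q_hol \<open>z \<in> V\<close>] B'_def mult.commute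
          mult.left_commute)
  qed
  have "Cauchy (\<lambda>n. B' n k)" for k
  proof (rule CauchyI)
    fix e :: real assume "0 < e"
    have "(\<lambda>n. K * norm k / R * t n) \<longlonglongrightarrow> 0"
      by (rule tendsto_mult_right_zero[OF t_lim])
    then obtain N where N: "\<And>n. n \<ge> N \<Longrightarrow> K * norm k / R * t n < e / 2"
      using order_tendstoD(2)[of "\<lambda>n. K * norm k / R * t n" 0 sequentially "e / 2"] \<open>0 < e\<close>
      unfolding eventually_sequentially by (meson half_gt_zero)
    show "\<exists>N. \<forall>m\<ge>N. \<forall>n\<ge>N. norm (B' m k - B' n k) < e"
    proof (intro exI allI impI)
      fix m n assume "N \<le> m" "N \<le> n"
      then show "norm (B' m k - B' n k) < e"
        using N[of m] N[of n] B'_diff[of m k n] unfolding distrib_left by linarith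
    qed
  qed
  then have "convergent (\<lambda>n. B' n k)" for k
    by (rule Cauchy_convergent)
  then obtain B where B: "\<And>k. (\<lambda>n. B' n k) \<longlonglongrightarrow> B k"
    unfolding convergent_def by metis
  have B_lin: "bounded_clinear B"
  proof (rule bounded_clinearI)
    show "B (x + y) = B x + B y" for x y
      using tendsto_add[OF B[of x] B[of y]] B[of "x + y"]
      by (simp add: bounded_clinear_add[OF B'_lin] LIMSEQ_unique)
    show "B (c *\<^sub>C x) = c *\<^sub>C B x" for c x
      using bounded_linear.tendsto[OF bounded_linear_scaleC_right[of c] B[of x]] B[of "c *\<^sub>C x"]
      by (simp add: bounded_clinearD(2)[OF B'_lin] LIMSEQ_unique)
    have "norm (B' n x) \<le> M' / R * norm x" for n x
      unfolding B'_def using cV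
      by (intro Cauchy_estimates_map(1)[OF q_hol cV R(1)] q_bound) auto
    then show "norm (B x) \<le> M' / R * norm x" for x
      using Lim_norm_ubound[OF _ B[of x]] by (simp add: always_eventually)
  qed
  have "((\<lambda>z. D z h) has_derivative B) (at z)"
  proof (rule has_derivative_of_quadratic_remainder)
    show "bounded_linear B" by (rule bounded_clinearD(1)[OF B_lin])
    show "0 < R / 2" using R by simp
    fix k :: 'a assume k: "norm k \<le> R / 2"
    then have "z + k \<in> cball z R" using R by (simp add: dist_norm)
    then have "z + k \<in> V" using cV by auto
    have lim: "(\<lambda>n. q n x) \<longlonglongrightarrow> D x h" if "x \<in> V" for x
    proof -
      have "(\<lambda>n. K * t n) \<longlonglongrightarrow> 0" by (rule tendsto_mult_right_zero[OF t_lim])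
      then have "(\<lambda>n. q n x - D x h) \<longlonglongrightarrow> 0"
        by (rule Lim_null_comparison[rotated]) (simp add: q_near[OF that] always_eventually)
      then show ?thesis by (simp add: LIM_zero_iff)
    qed
    have "(\<lambda>n. q n (z + k) - q n z - B' n k) \<longlonglongrightarrow> D (z + k) h - D z h - B k"
      by (intro tendsto_diff lim B \<open>z \<in> V\<close> \<open>z + k \<in> V\<close>)
    moreover have "norm (q n (z + k) - q n z - B' n k) \<le> 8 * M' / R\<^sup>2 * (norm k)\<^sup>2" for n
      unfolding B'_def using cV
      by (intro Cauchy_estimates_map(2)[OF q_hol cV R(1) _ k] q_bound) auto
    ultimately show "norm (D (z + k) h - D z h - B k) \<le> 8 * M' / R\<^sup>2 * (norm k)\<^sup>2"
      by (intro Lim_norm_ubound[OF sequentially_bot]) (auto intro: always_eventually)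
  qed
  then show "\<exists>L. bounded_clinear L \<and> ((\<lambda>z. frechet_derivative g (at z) h) has_derivative L) (at z)"
    using B_lin by (auto simp: D_def)
qed

text \<open>
  The invariant of the induction on the order of differentiation. The local bound is uniform in the
  arguments \<open>ws\<close>; it upgrades differentiability for each fixed \<open>ws\<close> to differentiability in operator
  norm.
\<close>

definition multilinear_holomorphic ::
  "nat \<Rightarrow> ('a::complex_banach \<Rightarrow> 'a list \<Rightarrow> 'b::complex_banach) \<Rightarrow> 'a set \<Rightarrow> bool" where
  "multilinear_holomorphic n G U \<longleftrightarrow>
    (\<forall>ws. length ws = n \<longrightarrow> holomorphic_map (\<lambda>z. G z ws) U) \<and>
    (\<forall>z\<in>U. bounded_cmultilinear n (G z)) \<and>
    (\<forall>z\<in>U. \<exists>R>0. \<exists>C\<ge>0. cball z R \<subseteq> U \<and>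
      (\<forall>y\<in>cball z R. \<forall>ws. length ws = n \<longrightarrow> norm (G y ws) \<le> C * (\<Prod>w\<leftarrow>ws. norm w)))"

lemma prod_list_norm_nonneg: "0 \<le> (\<Prod>w\<leftarrow>ws. norm (w::'a::real_normed_vector))"
  by (induction ws) auto

lemma prod_list_norm_update:
  fixes x :: "'a::real_normed_vector"
  assumes "i < length ws"
  shows "(\<Prod>w\<leftarrow>ws[i := x]. norm w) = norm x * (\<Prod>w\<leftarrow>take i ws @ drop (Suc i) ws. norm w)"
  using assms by (simp add: upd_conv_take_nth_drop)

lemma has_multilinear_derivative_directional:
  assumes D: "has_multilinear_derivative n G L z" and ws: "length ws = n"
  shows "((\<lambda>x. G x ws) has_derivative (\<lambda>h. L (h # ws))) (at z)"
    and "bounded_clinear (\<lambda>h. L (h # ws))"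
proof -
  have L: "bounded_cmultilinear (Suc n) L"
    using D by (simp add: has_multilinear_derivative_def)
  then have "bounded_clinear (\<lambda>x. L ((0 # ws)[0 := x]))"
    using ws unfolding bounded_cmultilinear_def by (metis length_Cons zero_less_Suc)
  then show lin: "bounded_clinear (\<lambda>h. L (h # ws))" by simp
  show "((\<lambda>x. G x ws) has_derivative (\<lambda>h. L (h # ws))) (at z)"
    unfolding has_derivative_at_alt
  proof (intro conjI allI impI)
    show "bounded_linear (\<lambda>h. L (h # ws))" by (rule bounded_clinearD(1)[OF lin])
    fix e :: real assume "0 < e"
    define p where "p = (\<Prod>w\<leftarrow>ws. norm w)"
    have "0 \<le> p" by (simp add: p_def prod_list_norm_nonneg)
    then have "0 < e / (p + 1)" using \<open>0 < e\<close> by simp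
    moreover have "\<forall>e>0. \<exists>d>0. \<forall>h. norm h < d \<longrightarrow>
        norm (G (z + h) ws - G z ws - L (h # ws)) \<le> e * norm h * p"
      using D ws unfolding has_multilinear_derivative_def p_def by blast
    ultimately obtain d where d: "0 < d" "\<And>h. norm h < d \<Longrightarrow>
        norm (G (z + h) ws - G z ws - L (h # ws)) \<le> e / (p + 1) * norm h * p"
      by meson
    have "norm (G y ws - G z ws - L ((y - z) # ws)) \<le> e * norm (y - z)" if "norm (y - z) < d" for y
    proof -
      have "norm (G y ws - G z ws - L ((y - z) # ws)) \<le> e / (p + 1) * norm (y - z) * p"
        using d(2)[OF that] by simp
      also have "\<dots> = e * norm (y - z) * (p / (p + 1))" by simp
      also have "\<dots> \<le> e * norm (y - z) * 1"
        using \<open>0 \<le> p\<close> \<open>0 < e\<close> by (intro mult_left_mono) auto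
      finally show ?thesis by simp
    qed
    then show "\<exists>d>0. \<forall>y. norm (y - z) < d \<longrightarrow>
        norm (G y ws - G z ws - L ((y - z) # ws)) \<le> e * norm (y - z)"
      using d(1) by blast
  qed
qed

lemma holomorphic_map_has_derivative_eq:
  assumes "holomorphic_map f U" "z \<in> U" "(f has_derivative L) (at z)"
  shows "frechet_derivative f (at z) = L"
  using frechet_derivative_at[OF assms(3)] by simp

text \<open>
  The candidate is the directional derivative for fixed arguments. Linearity in each of the old
  slots passes to the derivative, and the Cauchy estimates with \<open>M = C * (\<Prod>w\<leftarrow>ws. norm w)\<close> provide
  its bound and the uniform remainder.
\<close>

lemma has_multilinear_derivative_exists:
  fixes G :: "'a::complex_banach \<Rightarrow> 'a list \<Rightarrow> 'b::complex_banach"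
  assumes G: "multilinear_holomorphic n G U" and z: "z \<in> U"
  shows "\<exists>L. has_multilinear_derivative n G L z"
proof -
  have hol: "holomorphic_map (\<lambda>z. G z ws) U" if "length ws = n" for ws
    using G that by (simp add: multilinear_holomorphic_def)
  have ml: "bounded_cmultilinear n (G y)" if "y \<in> U" for y
    using G that by (simp add: multilinear_holomorphic_def)
  obtain R C where R: "0 < R" "0 \<le> C" "cball z R \<subseteq> U"
    and C: "\<And>y ws. y \<in> cball z R \<Longrightarrow> length ws = n \<Longrightarrow> norm (G y ws) \<le> C * (\<Prod>w\<leftarrow>ws. norm w)"
    using G z unfolding multilinear_holomorphic_def by meson
  \<comment> \<open>the head of the list is the new direction of differentiation\<close>
  define L where "L ws = frechet_derivative (\<lambda>x. G x (tl ws)) (at z) (hd ws)" for ws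
  have L_Cons: "L (h # ws) = frechet_derivative (\<lambda>x. G x ws) (at z) h" for h ws
    by (simp add: L_def)
  have L_bound: "norm (L (h # ws)) \<le> C / R * (\<Prod>w\<leftarrow>h # ws. norm w)" if "length ws = n" for h ws
    using Cauchy_estimates_map(1)[OF hol[OF that] R(3,1) C[OF _ that], of h]
    by (simp add: L_Cons mult.commute mult.left_commute)
  have "bounded_cmultilinear (Suc n) L"
    unfolding bounded_cmultilinear_def
  proof (intro conjI allI impI)
    fix ws :: "'a list" and i assume "length ws = Suc n \<and> i < Suc n"
    then obtain h vs where ws: "ws = h # vs" "length vs = n" and i: "i < Suc n"
      by (metis length_Suc_conv)
    show "bounded_clinear (\<lambda>x. L (ws[i := x]))"
    proof (cases i)
      case 0
      then show ?thesis
        using holomorphic_map_derivative(2)[OF hol[OF ws(2)] z] by (simp add: ws L_Cons)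
    next
      case (Suc j)
      then have "j < n" using i by simp
      have len: "length (vs[j := x]) = n" for x by (simp add: ws)
      note dv = holomorphic_map_derivative(1)[OF hol[OF len] z]
      have slot: "bounded_clinear (\<lambda>x. G y (vs[j := x]))" if "y \<in> U" for y
        using ml[OF that] ws(2) \<open>j < n\<close> by (simp add: bounded_cmultilinear_def)
      have "open U" using hol[OF ws(2)] by (simp add: holomorphic_map_def)
      have "bounded_clinear (\<lambda>x. L (h # vs[j := x]))"
      proof (rule bounded_clinearI)
        fix x x' :: 'a and c :: complex
        have "((\<lambda>y. G y (vs[j := x]) + G y (vs[j := x'])) has_derivative
            (\<lambda>k. L (k # vs[j := x]) + L (k # vs[j := x']))) (at z)"
          unfolding L_Cons by (rule has_derivative_add[OF dv dv])
        then have "((\<lambda>y. G y (vs[j := x + x'])) has_derivative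
            (\<lambda>k. L (k # vs[j := x]) + L (k # vs[j := x']))) (at z)"
          by (rule has_derivative_transform_within_open[OF _ \<open>open U\<close> z])
            (simp add: bounded_clinear_add[OF slot])
        then show "L (h # vs[j := x + x']) = L (h # vs[j := x]) + L (h # vs[j := x'])"
          using holomorphic_map_has_derivative_eq[OF hol[OF len] z] by (simp add: L_Cons)
        have "((\<lambda>y. c *\<^sub>C G y (vs[j := x])) has_derivative (\<lambda>k. c *\<^sub>C L (k # vs[j := x]))) (at z)"
          unfolding L_Cons
          by (rule bounded_linear.has_derivative[OF bounded_linear_scaleC_right dv])
        then have "((\<lambda>y. G y (vs[j := c *\<^sub>C x])) has_derivative
            (\<lambda>k. c *\<^sub>C L (k # vs[j := x]))) (at z)"
          by (rule has_derivative_transform_within_open[OF _ \<open>open U\<close> z])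
            (simp add: bounded_clinearD(2)[OF slot])
        then show "L (h # vs[j := c *\<^sub>C x]) = c *\<^sub>C L (h # vs[j := x])"
          using holomorphic_map_has_derivative_eq[OF hol[OF len] z] by (simp add: L_Cons)
        have "norm (L (h # vs[j := x])) \<le> C / R * (\<Prod>w\<leftarrow>h # vs[j := x]. norm w)"
          by (rule L_bound[OF len])
        also have "\<dots> = C / R * norm h * (\<Prod>w\<leftarrow>take j vs @ drop (Suc j) vs. norm w) * norm x"
          using \<open>j < n\<close> ws(2) by (simp add: prod_list_norm_update)
        finally show "norm (L (h # vs[j := x]))
            \<le> C / R * norm h * (\<Prod>w\<leftarrow>take j vs @ drop (Suc j) vs. norm w) * norm x" .
      qed
      then show ?thesis by (simp add: ws Suc)
    qed
  next
    have "norm (L ws) \<le> C / R * (\<Prod>w\<leftarrow>ws. norm w)" if ws: "length ws = Suc n" for ws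
    proof -
      obtain h vs where "ws = h # vs" "length vs = n" using ws by (metis length_Suc_conv)
      then show ?thesis using L_bound[of vs h] by simp
    qed
    then show "\<exists>C. \<forall>ws. length ws = Suc n \<longrightarrow> norm (L ws) \<le> C * (\<Prod>w\<leftarrow>ws. norm w)"
      by blast
  qed
  moreover have "\<exists>d>0. \<forall>h::'a. norm h < d \<longrightarrow> (\<forall>ws. length ws = n \<longrightarrow>
      norm (G (z + h) ws - G z ws - L (h # ws)) \<le> e * norm h * (\<Prod>w\<leftarrow>ws. norm w))"
    if "0 < e" for e :: real
  proof (intro exI conjI allI impI)
    define K where "K = 8 * C / R\<^sup>2"
    have "0 \<le> K" using R(2) by (simp add: K_def)
    show "0 < min (R / 2) (e / (K + 1))" using \<open>0 \<le> K\<close> R(1) that by simp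
    fix h :: 'a and ws :: "'a list"
    assume h: "norm h < min (R / 2) (e / (K + 1))" and ws: "length ws = n"
    let ?p = "\<Prod>w\<leftarrow>ws. norm w"
    have "norm (G (z + h) ws - G z ws - L (h # ws)) \<le> 8 * (C * ?p) / R\<^sup>2 * (norm h)\<^sup>2"
      unfolding L_Cons
      by (rule Cauchy_estimates_map(2)[OF hol[OF ws] R(3,1) C[OF _ ws]]) (use h in auto)
    also have "\<dots> = K * norm h * (norm h * ?p)" by (simp add: K_def power2_eq_square)
    also have "\<dots> \<le> e * (norm h * ?p)"
    proof (intro mult_right_mono)
      have "K * norm h \<le> (K + 1) * norm h" by (simp add: mult_right_mono)
      also have "\<dots> \<le> e" using h \<open>0 \<le> K\<close> by (simp add: field_simps)
      finally show "K * norm h \<le> e" .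
    qed (simp add: prod_list_norm_nonneg)
    finally show "norm (G (z + h) ws - G z ws - L (h # ws)) \<le> e * norm h * ?p"
      by (simp add: mult.assoc)
  qed
  ultimately show ?thesis unfolding has_multilinear_derivative_def by blast
qed

lemma multilinear_holomorphic_derivative:
  fixes G :: "'a::complex_banach \<Rightarrow> 'a list \<Rightarrow> 'b::complex_banach"
  assumes G: "multilinear_holomorphic n G U"
    and D: "\<And>z. z \<in> U \<Longrightarrow> has_multilinear_derivative n G (G' z) z"
  shows "multilinear_holomorphic (Suc n) G' U"
proof -
  have hol: "holomorphic_map (\<lambda>z. G z ws) U" if "length ws = n" for ws
    using G that by (simp add: multilinear_holomorphic_def)
  have G'_eq: "frechet_derivative (\<lambda>x. G x ws) (at z) h = G' z (h # ws)"
    if "z \<in> U" "length ws = n" for z h ws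
    using has_multilinear_derivative_directional(1)[OF D[OF that(1)] that(2)]
      holomorphic_map_has_derivative_eq[OF hol[OF that(2)] that(1)] by simp
  show ?thesis
    unfolding multilinear_holomorphic_def
  proof (intro conjI allI impI ballI)
    fix ws :: "'a list" assume "length ws = Suc n"
    then obtain h vs where ws: "ws = h # vs" "length vs = n" by (metis length_Suc_conv)
    have "holomorphic_map (\<lambda>z. frechet_derivative (\<lambda>x. G x vs) (at z) h) U"
      by (rule holomorphic_map_directional_derivative[OF hol[OF ws(2)]])
    moreover have "open U" using hol[OF ws(2)] by (simp add: holomorphic_map_def)
    ultimately show "holomorphic_map (\<lambda>z. G' z ws) U"
      unfolding holomorphic_map_def
      by (metis (no_types, lifting) G'_eq has_derivative_transform_within_open ws)
  next
    fix z assume "z \<in> U"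
    then show "bounded_cmultilinear (Suc n) (G' z)"
      using D by (simp add: has_multilinear_derivative_def)
    obtain R C where R: "0 < R" "0 \<le> C" "cball z R \<subseteq> U"
      and C: "\<And>y ws. y \<in> cball z R \<Longrightarrow> length ws = n \<Longrightarrow> norm (G y ws) \<le> C * (\<Prod>w\<leftarrow>ws. norm w)"
      using G \<open>z \<in> U\<close> unfolding multilinear_holomorphic_def by meson
    show "\<exists>R>0. \<exists>C\<ge>0. cball z R \<subseteq> U \<and>
      (\<forall>y\<in>cball z R. \<forall>ws. length ws = Suc n \<longrightarrow> norm (G' y ws) \<le> C * (\<Prod>w\<leftarrow>ws. norm w))"
    proof (intro exI conjI ballI allI impI)
      show "0 < R / 2" "0 \<le> C / (R / 2)" using R by auto
      show "cball z (R / 2) \<subseteq> U" using R by (intro order_trans[OF _ R(3)]) auto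
      fix y and ws :: "'a list" assume y: "y \<in> cball z (R / 2)" and "length ws = Suc n"
      then obtain h vs where ws: "ws = h # vs" "length vs = n" by (metis length_Suc_conv)
      have sub: "cball y (R / 2) \<subseteq> cball z R"
      proof
        fix x assume "x \<in> cball y (R / 2)"
        then show "x \<in> cball z R" using y dist_triangle[of z x y] by simp
      qed
      then have "y \<in> U" using R centre_in_cball[of y "R / 2"] by fastforce
      have "norm (frechet_derivative (\<lambda>x. G x vs) (at y) h)
          \<le> C * (\<Prod>w\<leftarrow>vs. norm w) / (R / 2) * norm h"
        using sub R by (intro Cauchy_estimates_map(1)[OF hol[OF ws(2)]] C ws(2)) auto
      then show "norm (G' y ws) \<le> C / (R / 2) * (\<Prod>w\<leftarrow>ws. norm w)"
        using G'_eq[OF \<open>y \<in> U\<close> ws(2)] by (simp add: ws mult.commute mult.left_commute)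
    qed
  qed
qed

theorem frechet_deriv_multilinear_holomorphic:
  fixes F :: "'a::complex_banach \<Rightarrow> 'b::complex_banach"
  assumes F: "holomorphic_map F U"
  shows "multilinear_holomorphic n (frechet_deriv n F) U"
proof (induction n)
  case 0
  have "\<exists>R>0. \<exists>C\<ge>0. cball z R \<subseteq> U \<and> (\<forall>y\<in>cball z R. norm (F y) \<le> C)" if "z \<in> U" for z
    using holomorphic_map_locally_bounded[OF F that] by metis
  then show ?case
    using F by (auto simp: multilinear_holomorphic_def bounded_cmultilinear_def)
next
  case (Suc n)
  show ?case
    by (rule multilinear_holomorphic_derivative[OF Suc])
      (simp add: someI_ex[OF has_multilinear_derivative_exists[OF Suc]])
qed

text \<open>
  As derivatives of all orders exist, the choice in the recursive definition of \<open>frechet_deriv\<close>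
  is always made among actual derivatives.
\<close>

corollary frechet_deriv_Suc:
  assumes F: "holomorphic_map F U" and z: "z \<in> U" and ws: "length ws = n"
  shows "((\<lambda>x. frechet_deriv n F x ws) has_derivative (\<lambda>h. frechet_deriv (Suc n) F z (h # ws))) (at z)"
    and "bounded_clinear (\<lambda>h. frechet_deriv (Suc n) F z (h # ws))"
proof -
  have "has_multilinear_derivative n (frechet_deriv n F) (frechet_deriv (Suc n) F z) z"
    using someI_ex[OF has_multilinear_derivative_exists[OF
          frechet_deriv_multilinear_holomorphic[OF F] z]] by simp
  from has_multilinear_derivative_directional[OF this ws]
  show "((\<lambda>x. frechet_deriv n F x ws) has_derivative (\<lambda>h. frechet_deriv (Suc n) F z (h # ws))) (at z)"
    and "bounded_clinear (\<lambda>h. frechet_deriv (Suc n) F z (h # ws))" .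
qed

theorem higher_deriv_along_line:
  fixes F :: "'a::complex_banach \<Rightarrow> 'b::complex_banach"
  assumes F: "holomorphic_map F U" and l: "bounded_clinear l" and "z + \<zeta> *\<^sub>C v \<in> U"
  shows "(deriv ^^ n) (\<lambda>\<zeta>. l (F (z + \<zeta> *\<^sub>C v))) \<zeta>
    = l (frechet_deriv n F (z + \<zeta> *\<^sub>C v) (replicate n v))"
  using assms(3)
proof (induction n arbitrary: \<zeta>)
  case 0
  then show ?case by simp
next
  case (Suc n)
  let ?S = "{\<zeta>. z + \<zeta> *\<^sub>C v \<in> U}"
  have "open ?S"
    using F by (intro open_line_preimage) (simp add: holomorphic_map_def)
  have "((\<lambda>\<zeta>. l (frechet_deriv n F (z + \<zeta> *\<^sub>C v) (replicate n v))) has_field_derivative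
      l (frechet_deriv (Suc n) F (z + \<zeta> *\<^sub>C v) (v # replicate n v))) (at \<zeta>)"
    by (intro has_field_derivative_along_line[OF _ _ l] frechet_deriv_Suc[OF F Suc.prems]) auto
  then have "((deriv ^^ n) (\<lambda>\<zeta>. l (F (z + \<zeta> *\<^sub>C v))) has_field_derivative
      l (frechet_deriv (Suc n) F (z + \<zeta> *\<^sub>C v) (v # replicate n v))) (at \<zeta>)"
    by (rule has_field_derivative_transform_within_open[OF _ \<open>open ?S\<close>])
      (use Suc in auto)
  then show ?case by (simp add: DERIV_imp_deriv)
qed

section \<open>Taylor coefficients of bounded functions on the disc\<close>

lemma of_real_cmod_square: "(complex_of_real (cmod z))\<^sup>2 = z * cnj z"
  by (metis complex_norm_square of_real_power)

lemma roots_of_unity_orthogonal: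
  fixes N :: nat
  defines "\<omega> \<equiv> \<lambda>j::nat. cis (2 * pi * real j / real N)"
  assumes "i < N" "k < N"
  shows "(\<Sum>j<N. \<omega> j ^ i * cnj (\<omega> j ^ k)) = (if i = k then of_nat N else 0)"
proof (cases "i = k")
  case True
  have "\<omega> j ^ i * cnj (\<omega> j ^ i) = 1" for j
    by (simp add: of_real_cmod_square[symmetric] norm_power \<omega>_def del: complex_cnj_power)
  then show ?thesis using True by simp
next
  case False
  define x where "x = \<omega> i * cnj (\<omega> k)"
  have pow: "\<omega> j ^ i = \<omega> i ^ j" for i j
    by (simp add: \<omega>_def Complex.DeMoivre mult.commute mult.left_commute)
  have "\<omega> i \<noteq> \<omega> k"
    using inj_onD[OF bij_betw_imp_inj_on[OF Complex.bij_betw_roots_unity[of N]], of i k] assms False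
    by (auto simp: \<omega>_def)
  have unit: "cnj (\<omega> k) * \<omega> k = 1"
    by (simp add: \<omega>_def of_real_cmod_square[symmetric] mult.commute[of "cnj _"])
  have "x \<noteq> 1"
  proof
    assume "x = 1"
    then have "\<omega> i * (cnj (\<omega> k) * \<omega> k) = \<omega> k" by (simp add: x_def mult.assoc)
    then show False using unit \<open>\<omega> i \<noteq> \<omega> k\<close> by simp
  qed
  have "\<omega> i ^ N = 1" for i
    using assms by (simp add: \<omega>_def Complex.DeMoivre cis_multiple_2pi)
  then have "x ^ N = 1"
    by (simp add: x_def power_mult_distrib flip: complex_cnj_power)
  have "(\<Sum>j<N. \<omega> j ^ i * cnj (\<omega> j ^ k)) = (\<Sum>j<N. x ^ j)"
    by (simp add: x_def pow[of _ i] pow[of _ k] power_mult_distrib)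
  also have "\<dots> = 0"
    using geometric_sum[OF \<open>x \<noteq> 1\<close>, of N] \<open>x ^ N = 1\<close> by simp
  finally show ?thesis using False by simp
qed

text \<open>
  Averages over roots of unity replace integrals over the circle: for a polynomial whose degree is
  less than the number of nodes, Parseval's identity is exact.
\<close>

lemma discrete_Parseval:
  fixes c :: "nat \<Rightarrow> complex" and N :: nat and s :: real
  defines "\<omega> \<equiv> \<lambda>j::nat. cis (2 * pi * real j / real N)"
  shows "(\<Sum>j<N. (cmod (\<Sum>i<N. c i * (of_real s * \<omega> j) ^ i))\<^sup>2)
    = real N * (\<Sum>i<N. (cmod (c i))\<^sup>2 * s ^ (2 * i))"
proof -
  let ?b = "\<lambda>i. c i * of_real (s ^ i)"
  have "complex_of_real (\<Sum>j<N. (cmod (\<Sum>i<N. c i * (of_real s * \<omega> j) ^ i))\<^sup>2)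
    = (\<Sum>j<N. \<Sum>i<N. \<Sum>k<N. ?b i * cnj (?b k) * (\<omega> j ^ i * cnj (\<omega> j ^ k)))"
    by (simp add: of_real_cmod_square sum_product power_mult_distrib mult_ac)
  also have "\<dots> = (\<Sum>i<N. \<Sum>k<N. ?b i * cnj (?b k) * (\<Sum>j<N. \<omega> j ^ i * cnj (\<omega> j ^ k)))"
    unfolding sum_distrib_left by (subst sum.swap) (intro sum.cong sum.swap refl)
  also have "\<dots> = (\<Sum>i<N. \<Sum>k<N. if i = k then ?b i * cnj (?b k) * of_nat N else 0)"
    unfolding \<omega>_def by (intro sum.cong refl) (subst roots_of_unity_orthogonal, auto)
  also have "\<dots> = (\<Sum>i<N. ?b i * cnj (?b i) * of_nat N)"
    by (simp add: sum.delta)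
  also have "\<dots> = (\<Sum>i<N. of_nat N * ((complex_of_real (cmod (c i)))\<^sup>2 * of_real (s ^ (2 * i))))"
    by (intro sum.cong refl) (simp add: of_real_cmod_square mult_2 mult_2_right power_add mult_ac)
  also have "\<dots> = complex_of_real (real N * (\<Sum>i<N. (cmod (c i))\<^sup>2 * s ^ (2 * i)))"
    by (simp add: sum_distrib_left)
  finally show ?thesis by (simp only: of_real_eq_iff)
qed

definition taylor_coeff :: "(complex \<Rightarrow> complex) \<Rightarrow> nat \<Rightarrow> complex" where
  "taylor_coeff f n = (deriv ^^ n) f 0 / fact n"

lemma taylor_coeff_sums:
  assumes "f holomorphic_on ball 0 1" and "cmod w < 1"
  shows "(\<lambda>n. taylor_coeff f n * w ^ n) sums f w"
  using holomorphic_power_series[OF assms(1), of w] assms(2) by (simp add: taylor_coeff_def)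

lemma taylor_coeff_abs_summable:
  assumes "f holomorphic_on ball 0 1" and "cmod w < 1"
  shows "summable (\<lambda>n. cmod (taylor_coeff f n * w ^ n))"
proof -
  obtain r where r: "cmod w < r" "r < 1" using dense[OF assms(2)] by blast
  then have r0: "0 < r" by (meson norm_ge_zero order.strict_trans1)
  then have "summable (\<lambda>n. taylor_coeff f n * (complex_of_real r) ^ n)"
    using taylor_coeff_sums[OF assms(1), of "of_real r"] r by (auto simp: sums_iff)
  from powser_insidea[OF this, of w] show ?thesis using r r0 by simp
qed

text \<open>
  Multiplication by a function bounded by one is a contraction of the Hardy space \<open>H\<^sup>2\<close>. The sum on
  the left consists of the first coefficients of \<open>f * p\<close>, where \<open>p\<close> is the polynomial with coefficients
  \<open>g\<close>. On the circle of radius \<open>s < 1\<close> a partial sum \<open>H\<close> of the series of \<open>f * p\<close> differs from \<open>f * p\<close> by at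
  most \<open>e\<close>, hence \<open>\<bar>H\<bar> \<le> \<bar>p\<bar> + e\<close>; Parseval's identity turns this into a comparison of
  coefficients, and \<open>e\<close> tends to zero before \<open>s\<close> tends to one.
\<close>

theorem multiplication_contraction:
  fixes g :: "nat \<Rightarrow> complex" and N :: nat
  assumes f: "f holomorphic_on ball 0 1" and f1: "\<And>w. cmod w < 1 \<Longrightarrow> cmod (f w) \<le> 1"
    and g0: "\<And>i. N \<le> i \<Longrightarrow> g i = 0"
  shows "(\<Sum>n<N. (cmod (\<Sum>i\<le>n. taylor_coeff f i * g (n - i)))\<^sup>2) \<le> (\<Sum>n<N. (cmod (g n))\<^sup>2)"
proof -
  define a where "a = taylor_coeff f"
  define h where "h n = (\<Sum>i\<le>n. a i * g (n - i))" for n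
  define p where "p w = (\<Sum>n<N. g n * w ^ n)" for w
  define G where "G = (\<Sum>n<N. cmod (g n))"
  have h_sums: "(\<lambda>n. h n * w ^ n) sums (f w * p w)" if w: "cmod w < 1" for w
  proof -
    have g_sums: "(\<lambda>n. g n * w ^ n) sums p w"
      unfolding p_def by (rule sums_finite) (auto simp: g0)
    have "summable (\<lambda>n. cmod (g n * w ^ n))"
      by (rule summable_finite[of "{..<N}"]) (auto simp: g0)
    from Cauchy_product_sums[OF taylor_coeff_abs_summable[OF f w] this]
    have "(\<lambda>n. \<Sum>i\<le>n. a i * w ^ i * (g (n - i) * w ^ (n - i))) sums (f w * p w)"
      using taylor_coeff_sums[OF f w] g_sums by (simp add: sums_iff a_def)
    moreover have "(\<Sum>i\<le>n. a i * w ^ i * (g (n - i) * w ^ (n - i))) = h n * w ^ n" for n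
      unfolding h_def sum_distrib_right
    proof (rule sum.cong)
      fix i assume "i \<in> {..n}"
      then have "w ^ n = w ^ i * w ^ (n - i)" by (simp flip: power_add)
      then show "a i * w ^ i * (g (n - i) * w ^ (n - i)) = a i * g (n - i) * w ^ n" by simp
    qed simp
    ultimately show ?thesis by simp
  qed
  have on_circle: "(\<Sum>n<N. (cmod (h n))\<^sup>2 * s ^ (2 * n)) \<le> (\<Sum>n<N. (cmod (g n))\<^sup>2) + e * (2 * G + e)"
    if s: "0 < s" "s < 1" and e: "0 < e" for s e
  proof -
    obtain r where r: "s < r" "r < 1" using dense[OF s(2)] by blast
    have "summable (\<lambda>n. h n * complex_of_real r ^ n)"
      using h_sums[of "of_real r"] r s by (auto simp: sums_iff)
    from powser_insidea[OF this, of "of_real s"]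
    have summ: "summable (\<lambda>n. cmod (h n) * s ^ n)"
      using r s by (simp add: norm_mult norm_power)
    then obtain L0 where L0: "\<And>n. n \<ge> L0 \<Longrightarrow> norm (\<Sum>i. cmod (h (i + n)) * s ^ (i + n)) < e"
      using suminf_exist_split[OF e summ] by blast
    define L where "L = max (max L0 N) 1"
    define H where "H w = (\<Sum>n<L. h n * w ^ n)" for w
    have close: "cmod (H w) \<le> cmod (p w) + e" if w: "cmod w = s" for w
    proof -
      have tail: "f w * p w - H w = (\<Sum>i. h (i + L) * w ^ (i + L))"
        using h_sums[of w] w s suminf_minus_initial_segment[of "\<lambda>n. h n * w ^ n" L]
        by (simp add: sums_iff H_def)
      moreover have "cmod (\<Sum>i. h (i + L) * w ^ (i + L)) \<le> (\<Sum>i. cmod (h (i + L) * w ^ (i + L)))"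
        by (rule summable_norm)
          (use summable_ignore_initial_segment[OF summ, of L] w in \<open>simp add: norm_mult norm_power\<close>)
      moreover have "(\<Sum>i. cmod (h (i + L) * w ^ (i + L))) < e"
      proof -
        have "L0 \<le> L" by (simp add: L_def)
        then have "\<bar>\<Sum>i. cmod (h (i + L)) * s ^ (i + L)\<bar> < e"
          using L0[of L] by (simp only: real_norm_def)
        then have "(\<Sum>i. cmod (h (i + L)) * s ^ (i + L)) < e" by linarith
        then show ?thesis by (simp only: norm_mult norm_power w)
      qed
      ultimately have "cmod (f w * p w - H w) \<le> e" unfolding tail by linarith
      moreover have "cmod (f w * p w) \<le> cmod (p w)"
        using f1[of w] w s mult_right_mono[of "cmod (f w)" 1 "cmod (p w)"] by (simp add: norm_mult)
      ultimately show ?thesis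
        using norm_triangle_ineq4[of "f w * p w" "f w * p w - H w"] by simp
    qed
    have p_le: "cmod (p w) \<le> G" if "cmod w = s" for w
      unfolding p_def G_def
    proof (rule order_trans[OF norm_sum sum_mono])
      fix n show "cmod (g n * w ^ n) \<le> cmod (g n)"
        using that s mult_left_mono[of "s ^ n" 1 "cmod (g n)"]
        by (simp add: norm_mult norm_power power_le_one)
    qed
    define \<omega> where "\<omega> j = of_real s * cis (2 * pi * real j / real L)" for j
    have \<omega>: "cmod (\<omega> j) = s" for j using s by (simp add: \<omega>_def norm_mult)
    have padded: "p w = (\<Sum>n<L. g n * w ^ n)" for w
      unfolding p_def by (rule sum.mono_neutral_left) (auto simp: L_def g0)
    have "real L * (\<Sum>n<L. (cmod (h n))\<^sup>2 * s ^ (2 * n)) = (\<Sum>j<L. (cmod (H (\<omega> j)))\<^sup>2)"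
      unfolding H_def \<omega>_def by (rule discrete_Parseval[symmetric])
    also have "\<dots> \<le> (\<Sum>j<L. (cmod (p (\<omega> j)))\<^sup>2 + e * (2 * G + e))"
    proof (rule sum_mono)
      fix j
      have "(cmod (H (\<omega> j)))\<^sup>2 \<le> (cmod (p (\<omega> j)) + e)\<^sup>2"
        by (intro power_mono close \<omega>) simp
      also have "\<dots> = (cmod (p (\<omega> j)))\<^sup>2 + e * (2 * cmod (p (\<omega> j)) + e)"
        by (simp add: power2_eq_square algebra_simps)
      also have "\<dots> \<le> (cmod (p (\<omega> j)))\<^sup>2 + e * (2 * G + e)"
        using p_le[OF \<omega>, of j] e by (intro add_left_mono mult_left_mono) auto
      finally show "(cmod (H (\<omega> j)))\<^sup>2 \<le> (cmod (p (\<omega> j)))\<^sup>2 + e * (2 * G + e)" .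
    qed
    also have "\<dots> = (\<Sum>j<L. (cmod (p (\<omega> j)))\<^sup>2) + real L * (e * (2 * G + e))"
      by (simp add: sum.distrib)
    also have "(\<Sum>j<L. (cmod (p (\<omega> j)))\<^sup>2) = real L * (\<Sum>n<L. (cmod (g n))\<^sup>2 * s ^ (2 * n))"
      unfolding padded \<omega>_def by (rule discrete_Parseval)
    finally have "real L * (\<Sum>n<L. (cmod (h n))\<^sup>2 * s ^ (2 * n))
        \<le> real L * ((\<Sum>n<L. (cmod (g n))\<^sup>2 * s ^ (2 * n)) + e * (2 * G + e))"
      by (simp add: distrib_left)
    then have "(\<Sum>n<L. (cmod (h n))\<^sup>2 * s ^ (2 * n))
        \<le> (\<Sum>n<L. (cmod (g n))\<^sup>2 * s ^ (2 * n)) + e * (2 * G + e)"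
      by (rule mult_left_le_imp_le) (simp add: L_def)
    moreover have "(\<Sum>n<N. (cmod (h n))\<^sup>2 * s ^ (2 * n)) \<le> (\<Sum>n<L. (cmod (h n))\<^sup>2 * s ^ (2 * n))"
      using s by (intro sum_mono2) (auto simp: L_def)
    moreover have "(\<Sum>n<L. (cmod (g n))\<^sup>2 * s ^ (2 * n)) \<le> (\<Sum>n<L. (cmod (g n))\<^sup>2)"
      using s by (intro sum_mono mult_left_le) (auto simp: power_le_one)
    moreover have "(\<Sum>n<L. (cmod (g n))\<^sup>2) = (\<Sum>n<N. (cmod (g n))\<^sup>2)"
      by (rule sum.mono_neutral_right) (auto simp: L_def g0)
    ultimately show ?thesis by linarith
  qed
  have "(\<Sum>n<N. (cmod (h n))\<^sup>2 * s ^ (2 * n)) \<le> (\<Sum>n<N. (cmod (g n))\<^sup>2)" if s: "0 < s" "s < 1" for s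
  proof (rule tendsto_lowerbound)
    show "((\<lambda>e. (\<Sum>n<N. (cmod (g n))\<^sup>2) + e * (2 * G + e)) \<longlongrightarrow> (\<Sum>n<N. (cmod (g n))\<^sup>2)) (at_right 0)"
      by (auto intro!: tendsto_eq_intros)
    show "\<forall>\<^sub>F e in at_right 0. (\<Sum>n<N. (cmod (h n))\<^sup>2 * s ^ (2 * n))
        \<le> (\<Sum>n<N. (cmod (g n))\<^sup>2) + e * (2 * G + e)"
      using on_circle[OF s] by (auto simp: eventually_at_right_less intro: eventually_at_rightI[of 0 1])
  qed simp
  note le = this
  have "(\<Sum>n<N. (cmod (h n))\<^sup>2) \<le> (\<Sum>n<N. (cmod (g n))\<^sup>2)"
  proof (rule tendsto_upperbound)
    show "((\<lambda>s. \<Sum>n<N. (cmod (h n))\<^sup>2 * s ^ (2 * n)) \<longlongrightarrow> (\<Sum>n<N. (cmod (h n))\<^sup>2)) (at_left (1::real))"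
      by (auto intro!: tendsto_eq_intros)
    show "\<forall>\<^sub>F s in at_left 1. (\<Sum>n<N. (cmod (h n))\<^sup>2 * s ^ (2 * n)) \<le> (\<Sum>n<N. (cmod (g n))\<^sup>2)"
      using le by (auto intro: eventually_at_leftI[of 0 1])
  qed simp
  then show ?thesis by (simp add: h_def a_def)
qed

lemma exists_unit_aligned:
  fixes x :: complex
  obtains e where "cmod e = 1" "\<And>t. 0 \<le> t \<Longrightarrow> cmod (x + e * complex_of_real t) = cmod x + t"
proof (cases "x = 0")
  case True
  then show thesis by (intro that[of 1]) auto
next
  case False
  show thesis
  proof (rule that[of "sgn x"])
    show "cmod (sgn x) = 1" using False by (simp add: norm_sgn)
    fix t :: real assume "0 \<le> t"
    have "x + sgn x * complex_of_real t = sgn x * complex_of_real (cmod x + t)"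
      using False by (simp add: sgn_eq algebra_simps)
    then show "cmod (x + sgn x * complex_of_real t) = cmod x + t"
      using False \<open>0 \<le> t\<close> by (simp add: norm_mult norm_sgn flip: of_real_add)
  qed
qed

text \<open>
  The contraction is applied to \<open>1 + e * (\<Sum>i\<le>n. cnj (a i) * z ^ (N - i))\<close> with \<open>N = 2 * n + 1\<close>. Its
  nonconstant terms start at degree \<open>n + 1\<close>, so the product begins with \<open>a 0, \<dots>, a n\<close>, while its
  coefficient at \<open>N\<close> is \<open>a N + e * S\<close> with \<open>S = (\<Sum>i\<le>n. (cmod (a i))\<^sup>2)\<close>. For \<open>e\<close> aligned with \<open>a N\<close> this gives
  \<open>S + (cmod (a N) + S)\<^sup>2 \<le> 1 + S\<close>.
\<close>

theorem Carlson_odd: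
  assumes f: "f holomorphic_on ball 0 1" and f1: "\<And>w. cmod w < 1 \<Longrightarrow> cmod (f w) \<le> 1"
  shows "cmod (taylor_coeff f (2 * n + 1)) \<le> 1 - (\<Sum>i\<le>n. (cmod (taylor_coeff f i))\<^sup>2)"
proof -
  define a where "a = taylor_coeff f"
  define N where "N = 2 * n + 1"
  define S where "S = (\<Sum>i\<le>n. (cmod (a i))\<^sup>2)"
  have "0 \<le> S" by (simp add: S_def sum_nonneg)
  obtain e where e: "cmod e = 1" "cmod (a N + e * of_real S) = cmod (a N) + S"
    using exists_unit_aligned[of "a N"] \<open>0 \<le> S\<close> by metis
  define g where "g i = (if i = 0 then 1 else if n < i \<and> i \<le> N then e * cnj (a (N - i)) else 0)" for i
  define h where "h k = (\<Sum>i\<le>k. a i * g (k - i))" for k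
  have "(\<Sum>k<Suc N. (cmod (h k))\<^sup>2) \<le> (\<Sum>k<Suc N. (cmod (g k))\<^sup>2)"
    unfolding h_def a_def by (rule multiplication_contraction[OF f f1]) (auto simp: g_def)
  moreover have "(\<Sum>k<Suc N. (cmod (g k))\<^sup>2) = 1 + S"
  proof -
    have "(\<Sum>k<Suc N. (cmod (g k))\<^sup>2) = (\<Sum>k\<in>{0} \<union> {Suc n..N}. (cmod (g k))\<^sup>2)"
      by (rule sum.mono_neutral_right) (auto simp: g_def N_def)
    also have "\<dots> = 1 + (\<Sum>k\<in>{Suc n..N}. (cmod (g k))\<^sup>2)"
      by (subst sum.union_disjoint) (auto simp: g_def)
    also have "(\<Sum>k\<in>{Suc n..N}. (cmod (g k))\<^sup>2) = S"
      unfolding S_def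
      by (rule sum.reindex_bij_witness[of _ "\<lambda>i. N - i" "\<lambda>i. N - i"])
        (auto simp: g_def N_def norm_mult e)
    finally show ?thesis .
  qed
  moreover have "S + (cmod (a N) + S)\<^sup>2 \<le> (\<Sum>k<Suc N. (cmod (h k))\<^sup>2)"
  proof -
    have "h k = a k" if "k \<le> n" for k
    proof -
      have "h k = (\<Sum>i\<in>{k}. a i * g (k - i))"
        unfolding h_def by (rule sum.mono_neutral_right) (use that in \<open>auto simp: g_def\<close>)
      then show ?thesis by (simp add: g_def)
    qed
    then have "S = (\<Sum>k\<le>n. (cmod (h k))\<^sup>2)" by (simp add: S_def)
    moreover have "h N = a N + e * of_real S"
    proof -
      have "h N = (\<Sum>i\<in>{..n} \<union> {N}. a i * g (N - i))"
        unfolding h_def by (rule sum.mono_neutral_right) (auto simp: g_def N_def)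
      also have "\<dots> = (\<Sum>i\<le>n. a i * g (N - i)) + a N"
        by (subst sum.union_disjoint) (auto simp: g_def N_def)
      also have "(\<Sum>i\<le>n. a i * g (N - i)) = (\<Sum>i\<le>n. e * of_real ((cmod (a i))\<^sup>2))"
        by (rule sum.cong) (auto simp: g_def N_def of_real_cmod_square)
      finally show ?thesis by (simp add: S_def sum_distrib_left)
    qed
    ultimately have "S + (cmod (a N) + S)\<^sup>2 = (\<Sum>k\<le>n. (cmod (h k))\<^sup>2) + (cmod (h N))\<^sup>2"
      using e(2) by presburger
    also have "\<dots> = (\<Sum>k\<in>{..n} \<union> {N}. (cmod (h k))\<^sup>2)"
      by (subst sum.union_disjoint) (auto simp: N_def)
    also have "\<dots> \<le> (\<Sum>k<Suc N. (cmod (h k))\<^sup>2)"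
      by (rule sum_mono2) (auto simp: N_def)
    finally show ?thesis .
  qed
  ultimately have "(cmod (a N) + S)\<^sup>2 \<le> 1\<^sup>2" by simp
  then have "cmod (a N) + S \<le> 1" by (rule power2_le_imp_le) simp
  then show ?thesis by (simp add: a_def N_def S_def)
qed

text \<open>
  As in the odd case, with an additional term \<open>c * z ^ n\<close> in the test polynomial, which contributes
  \<open>c * a n\<close> to the top coefficient. The size \<open>\<gamma> = 1 / (1 + cmod (a 0))\<close> of \<open>c / cnj (a n)\<close> is chosen
  so that \<open>1 - \<gamma> * cmod (a 0) = \<gamma>\<close>: then the coefficient \<open>a n + c * a 0\<close> of the product has at least the modulus
  of \<open>c\<close>, and the two cancel in the comparison.
\<close>

theorem Carlson_even:
  assumes f: "f holomorphic_on ball 0 1" and f1: "\<And>w. cmod w < 1 \<Longrightarrow> cmod (f w) \<le> 1"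
    and "0 < n"
  shows "cmod (taylor_coeff f (2 * n)) \<le> 1 - (\<Sum>i<n. (cmod (taylor_coeff f i))\<^sup>2)
    - (cmod (taylor_coeff f n))\<^sup>2 / (1 + cmod (taylor_coeff f 0))"
proof -
  define a where "a = taylor_coeff f"
  define N where "N = 2 * n"
  define S where "S = (\<Sum>i<n. (cmod (a i))\<^sup>2)"
  define \<gamma> where "\<gamma> = 1 / (1 + cmod (a 0))"
  have "0 \<le> S" by (simp add: S_def sum_nonneg)
  have "0 < \<gamma>" by (simp add: \<gamma>_def add_pos_nonneg)
  have \<gamma>: "1 - \<gamma> * cmod (a 0) = \<gamma>"
  proof -
    have "1 + cmod (a 0) \<noteq> 0" using norm_ge_zero[of "a 0"] by linarith
    then show ?thesis by (simp add: \<gamma>_def field_simps)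
  qed
  define T where "T = S + \<gamma> * (cmod (a n))\<^sup>2"
  have "0 \<le> T" using \<open>0 \<le> S\<close> \<open>0 < \<gamma>\<close> by (simp add: T_def)
  obtain e where e: "cmod e = 1" "cmod (a N + e * of_real T) = cmod (a N) + T"
    using exists_unit_aligned[of "a N"] \<open>0 \<le> T\<close> by metis
  define c where "c = e * of_real \<gamma> * cnj (a n)"
  have c: "cmod c = \<gamma> * cmod (a n)" using \<open>0 < \<gamma>\<close> by (simp add: c_def norm_mult e)
  define g where "g i = (if i = 0 then 1 else if i = n then c
    else if n < i \<and> i \<le> N then e * cnj (a (N - i)) else 0)" for i
  define h where "h k = (\<Sum>i\<le>k. a i * g (k - i))" for k
  have "(\<Sum>k<Suc N. (cmod (h k))\<^sup>2) \<le> (\<Sum>k<Suc N. (cmod (g k))\<^sup>2)"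
    unfolding h_def a_def by (rule multiplication_contraction[OF f f1]) (auto simp: g_def N_def)
  moreover have "(\<Sum>k<Suc N. (cmod (g k))\<^sup>2) = 1 + (cmod c)\<^sup>2 + S"
  proof -
    have "(\<Sum>k<Suc N. (cmod (g k))\<^sup>2) = (\<Sum>k\<in>{0, n} \<union> {Suc n..N}. (cmod (g k))\<^sup>2)"
      by (rule sum.mono_neutral_right) (auto simp: g_def N_def)
    also have "\<dots> = 1 + (cmod c)\<^sup>2 + (\<Sum>k\<in>{Suc n..N}. (cmod (g k))\<^sup>2)"
      using \<open>0 < n\<close> by (subst sum.union_disjoint) (auto simp: g_def)
    also have "(\<Sum>k\<in>{Suc n..N}. (cmod (g k))\<^sup>2) = S"
      unfolding S_def
      by (rule sum.reindex_bij_witness[of _ "\<lambda>i. N - i" "\<lambda>i. N - i"])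
        (auto simp: g_def N_def norm_mult e)
    finally show ?thesis .
  qed
  moreover have "S + (cmod c)\<^sup>2 + (cmod (a N) + T)\<^sup>2 \<le> (\<Sum>k<Suc N. (cmod (h k))\<^sup>2)"
  proof -
    have "h k = a k" if "k < n" for k
    proof -
      have "h k = (\<Sum>i\<in>{k}. a i * g (k - i))"
        unfolding h_def by (rule sum.mono_neutral_right) (use that in \<open>auto simp: g_def\<close>)
      then show ?thesis by (simp add: g_def)
    qed
    then have S: "S = (\<Sum>k<n. (cmod (h k))\<^sup>2)" by (simp add: S_def)
    have "h n = (\<Sum>i\<in>{0, n}. a i * g (n - i))"
      unfolding h_def by (rule sum.mono_neutral_right) (auto simp: g_def)
    then have hn: "h n = a n + c * a 0" using \<open>0 < n\<close> by (simp add: g_def)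
    have "cmod c \<le> cmod (h n)"
    proof -
      have "cmod c = cmod (a n) * (1 - \<gamma> * cmod (a 0))" by (simp add: \<gamma> c)
      also have "\<dots> = cmod (a n) - cmod (c * a 0)" by (simp add: norm_mult c algebra_simps)
      also have "\<dots> \<le> cmod (h n)"
        using norm_triangle_ineq4[of "a n + c * a 0" "c * a 0"] by (simp add: hn)
      finally show ?thesis .
    qed
    moreover have hN: "h N = a N + e * of_real T"
    proof -
      have "h N = (\<Sum>i\<in>{..<n} \<union> {n, N}. a i * g (N - i))"
        unfolding h_def by (rule sum.mono_neutral_right) (auto simp: g_def N_def)
      also have "\<dots> = (\<Sum>i<n. a i * g (N - i)) + (a n * c + a N)"
        using \<open>0 < n\<close> by (subst sum.union_disjoint) (auto simp: g_def N_def)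
      also have "(\<Sum>i<n. a i * g (N - i)) = (\<Sum>i<n. e * of_real ((cmod (a i))\<^sup>2))"
        by (rule sum.cong) (auto simp: g_def N_def of_real_cmod_square)
      also have "a n * c = e * of_real (\<gamma> * (cmod (a n))\<^sup>2)"
        by (simp add: c_def of_real_cmod_square)
      finally show ?thesis by (simp add: S_def T_def sum_distrib_left distrib_left)
    qed
    ultimately have "S + (cmod c)\<^sup>2 + (cmod (a N) + T)\<^sup>2 \<le> (\<Sum>k<n. (cmod (h k))\<^sup>2)
        + ((cmod (h n))\<^sup>2 + (cmod (h N))\<^sup>2)"
      by (simp add: S hN e power_mono)
    also have "\<dots> = (\<Sum>k\<in>{..<n} \<union> {n, N}. (cmod (h k))\<^sup>2)"
      using \<open>0 < n\<close> by (subst sum.union_disjoint) (auto simp: N_def)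
    also have "\<dots> \<le> (\<Sum>k<Suc N. (cmod (h k))\<^sup>2)"
      by (rule sum_mono2) (auto simp: N_def)
    finally show ?thesis .
  qed
  ultimately have "(cmod (a N) + T)\<^sup>2 \<le> 1\<^sup>2" by simp
  then have "cmod (a N) + T \<le> 1" by (rule power2_le_imp_le) simp
  then show ?thesis by (simp add: a_def N_def S_def T_def \<gamma>_def)
qed

lemma taylor_coeff_0 [simp]: "taylor_coeff f 0 = f 0"
  by (simp add: taylor_coeff_def)

lemma taylor_coeff_bound:
  assumes f: "f holomorphic_on ball 0 1" and f1: "\<And>w. cmod w < 1 \<Longrightarrow> cmod (f w) \<le> 1"
  shows "cmod (taylor_coeff f 1) \<le> 1 - (cmod (f 0))\<^sup>2"
    and "cmod (taylor_coeff f 2) \<le> 1 - (cmod (f 0))\<^sup>2"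
proof -
  show "cmod (taylor_coeff f 1) \<le> 1 - (cmod (f 0))\<^sup>2"
    using Carlson_odd[OF f f1, of 0] by simp
  have "cmod (taylor_coeff f 2) \<le> 1 - (cmod (f 0))\<^sup>2
      - (cmod (taylor_coeff f 1))\<^sup>2 / (1 + cmod (f 0))"
    using Carlson_even[OF f f1, of 1] by simp
  also have "\<dots> \<le> 1 - (cmod (f 0))\<^sup>2" by (simp add: add_nonneg_nonneg)
  finally show "cmod (taylor_coeff f 2) \<le> 1 - (cmod (f 0))\<^sup>2" .
qed

section \<open>The refined Bohr sum\<close>

text \<open>
  Kept in closed form, the remainder on the right makes the induction step an identity up to the two
  coefficient inequalities: the step adds the terms of order \<open>2 * M + 3\<close> and \<open>2 * M + 4\<close>, and the square of
  \<open>b (M + 2)\<close> enters with the weight \<open>x ^ (2 * M + 4) / (1 + b 0)\<close> from the even inequality and with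
  \<open>x ^ (2 * M + 5) / (1 - x)\<close> from the geometric tail of all later ones.
\<close>

lemma refined_Bohr_partial_sum:
  fixes b :: "nat \<Rightarrow> real" and x :: real
  assumes x: "0 \<le> x" "x < 1" and b: "\<And>n. 0 \<le> b n"
    and odd: "\<And>n. b (2 * n + 1) \<le> 1 - (\<Sum>i\<le>n. (b i)\<^sup>2)"
    and even: "\<And>n. 0 < n \<Longrightarrow> b (2 * n) \<le> 1 - (\<Sum>i<n. (b i)\<^sup>2) - (b n)\<^sup>2 / (1 + b 0)"
  shows "(\<Sum>j<2 * M. b (j + 3) * x ^ (j + 3)) + (b 1)\<^sup>2 * x ^ 3 / (1 - x)
      + (1 / (1 + b 0) + x / (1 - x)) * (\<Sum>j<M. (b (j + 2) * x ^ (j + 2))\<^sup>2)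
    \<le> (1 - (b 0)\<^sup>2) * x ^ 3 / (1 - x) - (1 - (\<Sum>i\<le>M + 1. (b i)\<^sup>2)) * x ^ (2 * M + 3) / (1 - x)"
proof (induction M)
  case 0
  have "(b 1)\<^sup>2 * t = (1 - (b 0)\<^sup>2) * t - (1 - ((b 0)\<^sup>2 + (b 1)\<^sup>2)) * t" for t
    by (simp add: algebra_simps)
  from this[of "x ^ 3 / (1 - x)"] show ?case by simp
next
  case (Suc M)
  define E where "E = 1 - (\<Sum>i\<le>M + 1. (b i)\<^sup>2)"
  define y where "y = x ^ (2 * M + 3)"
  define u where "u = (b (M + 2))\<^sup>2"
  have "0 \<le> y" using x by (simp add: y_def)
  have o: "b (2 * M + 3) \<le> E"
    using odd[of "M + 1"] by (simp add: E_def numeral_3_eq_3)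
  have e: "b (2 * M + 4) \<le> E - u / (1 + b 0)"
  proof -
    have eqs: "2 * (M + 2) = 2 * M + 4" "{..<M + 2} = {..M + 1}" by auto
    show ?thesis using even[of "M + 2"] unfolding E_def u_def eqs by simp
  qed
  have yx: "x ^ (2 * M + 4) = x * y" "x ^ (2 * Suc M + 3) = x\<^sup>2 * y" "(x ^ (M + 2))\<^sup>2 = x * y"
    by (simp_all add: y_def power_add power_mult numeral_eq_Suc mult_ac)
  have sum1: "(\<Sum>j<2 * Suc M. b (j + 3) * x ^ (j + 3))
      = (\<Sum>j<2 * M. b (j + 3) * x ^ (j + 3)) + b (2 * M + 3) * y + b (2 * M + 4) * (x * y)"
    by (simp add: y_def yx(1)[unfolded y_def] numeral_eq_Suc add_ac)
  have odd_le: "b (2 * M + 3) * y \<le> E * y"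
    using o \<open>0 \<le> y\<close> by (rule mult_right_mono)
  have even_le: "b (2 * M + 4) * (x * y) \<le> E * (x * y) - u / (1 + b 0) * (x * y)"
    using e \<open>0 \<le> y\<close> x unfolding left_diff_distrib[symmetric] by (intro mult_right_mono) auto
  have sum2: "(1 / (1 + b 0) + x / (1 - x)) * (\<Sum>j<Suc M. (b (j + 2) * x ^ (j + 2))\<^sup>2)
      = (1 / (1 + b 0) + x / (1 - x)) * (\<Sum>j<M. (b (j + 2) * x ^ (j + 2))\<^sup>2)
        + u / (1 + b 0) * (x * y) + x / (1 - x) * (u * (x * y))"
  proof -
    have "(b (M + 2) * x ^ (M + 2))\<^sup>2 = u * (x * y)"
      unfolding power_mult_distrib yx(3) u_def ..
    then show ?thesis by (simp add: algebra_simps)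
  qed
  have tail: "E * y / (1 - x) - (E - u) * (x\<^sup>2 * y) / (1 - x)
      = E * y + E * (x * y) + x / (1 - x) * (u * (x * y))"
  proof -
    have "E * y - (E - u) * (x\<^sup>2 * y) = (E * y + E * (x * y)) * (1 - x) + x * (u * (x * y))"
      by (simp add: algebra_simps power2_eq_square)
    then have "(E * y - (E - u) * (x\<^sup>2 * y)) / (1 - x)
        = ((E * y + E * (x * y)) * (1 - x) + x * (u * (x * y))) / (1 - x)" by simp
    then show ?thesis
      using x unfolding diff_divide_distrib add_divide_distrib by simp
  qed
  have E_Suc: "1 - (\<Sum>i\<le>Suc M + 1. (b i)\<^sup>2) = E - u"
    by (simp add: E_def u_def)
  show ?case
    using Suc.IH[folded E_def y_def] odd_le even_le tail
    unfolding sum1 sum2 yx(2) E_Suc by linarith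
qed

theorem refined_Bohr_sum:
  fixes b :: "nat \<Rightarrow> real" and x :: real
  assumes x: "0 \<le> x" "x < 1" and b: "\<And>n. 0 \<le> b n"
    and odd: "\<And>n. b (2 * n + 1) \<le> 1 - (\<Sum>i\<le>n. (b i)\<^sup>2)"
    and even: "\<And>n. 0 < n \<Longrightarrow> b (2 * n) \<le> 1 - (\<Sum>i<n. (b i)\<^sup>2) - (b n)\<^sup>2 / (1 + b 0)"
  shows "summable (\<lambda>j. b (j + 3) * x ^ (j + 3))"
    and "summable (\<lambda>j. (b (j + 2) * x ^ (j + 2))\<^sup>2)"
    and "(\<Sum>j. b (j + 3) * x ^ (j + 3)) + (b 1)\<^sup>2 * x ^ 3 / (1 - x)
        + (1 / (1 + b 0) + x / (1 - x)) * (\<Sum>j. (b (j + 2) * x ^ (j + 2))\<^sup>2)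
      \<le> (1 - (b 0)\<^sup>2) * x ^ 3 / (1 - x)"
proof -
  have b1: "b n \<le> 1" for n
  proof (cases "even n")
    case True
    show ?thesis
    proof (cases "n = 0")
      case True
      have "(b 0)\<^sup>2 \<le> 1\<^sup>2" using odd[of 0] b[of 1] by simp
      then have "b 0 \<le> 1" by (rule power2_le_imp_le) simp
      then show ?thesis using True by simp
    next
      case False
      with \<open>even n\<close> obtain k where "n = 2 * k" "0 < k" by (auto elim!: evenE)
      moreover have "0 \<le> (\<Sum>i<k. (b i)\<^sup>2)" "0 \<le> (b k)\<^sup>2 / (1 + b 0)"
        using b[of 0] by (auto intro!: sum_nonneg)
      ultimately show ?thesis using even[of k] by simp
    qed
  next
    case False
    then obtain k where "n = 2 * k + 1" by (auto elim!: oddE)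
    moreover have "0 \<le> (\<Sum>i\<le>k. (b i)\<^sup>2)" by (auto intro!: sum_nonneg)
    ultimately show ?thesis using odd[of k] by simp
  qed
  show s1: "summable (\<lambda>j. b (j + 3) * x ^ (j + 3))"
  proof (rule summable_comparison_test')
    show "summable (\<lambda>j. x ^ j)" using x by (simp add: summable_geometric)
    fix j :: nat
    have "b (j + 3) * x ^ (j + 3) \<le> 1 * x ^ j"
      using x b1 b by (intro mult_mono power_decreasing) auto
    then show "norm (b (j + 3) * x ^ (j + 3)) \<le> x ^ j" using b x by simp
  qed
  show s2: "summable (\<lambda>j. (b (j + 2) * x ^ (j + 2))\<^sup>2)"
  proof (rule summable_comparison_test')
    show "summable (\<lambda>j. x ^ j)" using x by (simp add: summable_geometric)
    fix j :: nat
    have le: "b (j + 2) * x ^ (j + 2) \<le> 1 * x ^ j"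
      using x b1 b by (intro mult_mono power_decreasing) auto
    have "b (j + 2) * x ^ (j + 2) \<le> 1"
      using x b b1 by (intro mult_le_one power_le_one) auto
    then have "(b (j + 2) * x ^ (j + 2)) * (b (j + 2) * x ^ (j + 2)) \<le> (1 * x ^ j) * 1"
      using x b by (intro mult_mono[OF le]) auto
    then have "(b (j + 2) * x ^ (j + 2))\<^sup>2 \<le> x ^ j"
      by (simp only: power2_eq_square mult_1 mult_1_right)
    then show "norm ((b (j + 2) * x ^ (j + 2))\<^sup>2) \<le> x ^ j" by simp
  qed
  let ?B = "(1 - (b 0)\<^sup>2) * x ^ 3 / (1 - x)"
  have "(\<Sum>j<2 * M. b (j + 3) * x ^ (j + 3)) + (b 1)\<^sup>2 * x ^ 3 / (1 - x)
      + (1 / (1 + b 0) + x / (1 - x)) * (\<Sum>j<M. (b (j + 2) * x ^ (j + 2))\<^sup>2) \<le> ?B" for M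
  proof -
    have "0 \<le> 1 - (\<Sum>i\<le>M + 1. (b i)\<^sup>2)"
      using odd[of "M + 1"] b[of "2 * (M + 1) + 1"] by linarith
    then have "0 \<le> (1 - (\<Sum>i\<le>M + 1. (b i)\<^sup>2)) * x ^ (2 * M + 3) / (1 - x)"
      using x by (intro divide_nonneg_nonneg mult_nonneg_nonneg) auto
    then show ?thesis
      using refined_Bohr_partial_sum[OF x b odd even, of M] by linarith
  qed
  moreover have "(\<lambda>M. \<Sum>j<2 * M. b (j + 3) * x ^ (j + 3)) \<longlonglongrightarrow> (\<Sum>j. b (j + 3) * x ^ (j + 3))"
    using LIMSEQ_subseq_LIMSEQ[OF summable_LIMSEQ[OF s1], of "\<lambda>M. 2 * M"]
    by (simp add: o_def strict_mono_def)
  ultimately show "(\<Sum>j. b (j + 3) * x ^ (j + 3)) + (b 1)\<^sup>2 * x ^ 3 / (1 - x)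
        + (1 / (1 + b 0) + x / (1 - x)) * (\<Sum>j. (b (j + 2) * x ^ (j + 2))\<^sup>2) \<le> ?B"
    by (intro LIMSEQ_le_const2[OF tendsto_add[OF tendsto_add[OF _ tendsto_const]
            tendsto_mult[OF tendsto_const summable_LIMSEQ[OF s2]]]]) auto
qed

section \<open>Schwarz and Schwarz--Pick estimates\<close>

text \<open>
  The maximum principle for \<open>f w / w ^ k\<close> on discs of radius \<open>s < 1\<close>, followed by \<open>s \<longlongrightarrow> 1\<close>. The
  hypothesis \<open>cmod (f w) \<le> 1\<close> instead of strict inequality admits unimodular constants.
\<close>

lemma Schwarz_lemma_order:
  assumes f: "f holomorphic_on ball 0 1" and f1: "\<And>w. cmod w < 1 \<Longrightarrow> cmod (f w) \<le> 1"
    and zero: "\<And>j. j < k \<Longrightarrow> (deriv ^^ j) f 0 = 0" and z: "cmod z < 1"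
  shows "cmod (f z) \<le> cmod z ^ k"
proof -
  define a where "a = taylor_coeff f"
  have a0: "a j = 0" if "j < k" for j
    using zero[OF that] by (simp add: a_def taylor_coeff_def)
  define g where "g w = (\<Sum>n. a (n + k) * w ^ n)" for w
  have g_sums: "(\<lambda>n. a (n + k) * w ^ n) sums g w" and fg: "f w = w ^ k * g w" if w: "cmod w < 1" for w
  proof -
    have "(\<lambda>n. a n * w ^ n) sums f w"
      unfolding a_def by (rule taylor_coeff_sums[OF f w])
    then have "(\<lambda>n. a (n + k) * w ^ (n + k)) sums f w"
      using sums_iff_shift[of "\<lambda>n. a n * w ^ n" k] a0 by simp
    then have *: "(\<lambda>n. w ^ k * (a (n + k) * w ^ n)) sums f w"
      by (simp add: power_add mult_ac)
    show g_sums: "(\<lambda>n. a (n + k) * w ^ n) sums g w"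
    proof (cases "w = 0")
      case True
      then show ?thesis
        using powser_sums_zero[of "\<lambda>n. a (n + k)"] by (simp add: g_def sums_iff)
    next
      case False
      then show ?thesis
        using * unfolding g_def by (intro summable_sums) (simp add: sums_iff summable_cmult_iff)
    qed
    show "f w = w ^ k * g w"
      using sums_unique2[OF * sums_mult[OF g_sums]] .
  qed
  have g_hol: "g holomorphic_on ball 0 1"
    by (rule power_series_holomorphic[where a = "\<lambda>n. a (n + k)"]) (use g_sums in simp)
  have "cmod (f z) * s ^ k \<le> cmod z ^ k" if s: "cmod z < s" "s < 1" for s
  proof -
    have s0: "0 < s" using s by (meson norm_ge_zero order.strict_trans1)
    have "cmod (g z) \<le> 1 / s ^ k"
    proof (rule maximum_modulus_frontier[of g "ball 0 s"])
      show "g holomorphic_on interior (ball 0 s)"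
        using g_hol by (rule holomorphic_on_subset) (use s in auto)
      have "g holomorphic_on closure (ball 0 s)"
        using g_hol by (rule holomorphic_on_subset) (use s s0 in auto)
      then show "continuous_on (closure (ball 0 s)) g"
        by (rule holomorphic_on_imp_continuous_on)
      show "cmod (g w) \<le> 1 / s ^ k" if "w \<in> frontier (ball 0 s)" for w
      proof -
        have w: "cmod w = s" using that s0 by (simp add: frontier_ball)
        then have "s ^ k * cmod (g w) \<le> 1"
          using f1[of w] fg[of w] s by (simp add: norm_mult norm_power)
        then show ?thesis using s0 by (simp add: field_simps)
      qed
    qed (use s in auto)
    then have "cmod z ^ k * (cmod (g z) * s ^ k) \<le> cmod z ^ k * 1"
      using s0 by (intro mult_left_mono) (auto simp: field_simps)
    then show ?thesis using fg[OF z] by (simp add: norm_mult norm_power mult_ac)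
  qed
  note le = this
  show ?thesis
  proof (rule tendsto_upperbound)
    show "((\<lambda>s. cmod (f z) * s ^ k) \<longlongrightarrow> cmod (f z)) (at_left 1)"
      by (auto intro!: tendsto_eq_intros)
    show "\<forall>\<^sub>F s in at_left 1. cmod (f z) * s ^ k \<le> cmod z ^ k"
      using le z by (auto intro: eventually_at_leftI[of "cmod z" 1])
  qed simp
qed

lemma one_minus_cnj_mult_nonzero:
  assumes "cmod a < 1" "cmod w \<le> 1"
  shows "1 - cnj a * w \<noteq> 0"
proof
  assume "1 - cnj a * w = 0"
  then have "cmod (cnj a * w) = 1" by simp
  moreover have "cmod (cnj a * w) \<le> cmod a * 1"
    unfolding norm_mult using assms by (intro mult_mono) auto
  ultimately show False using assms by simp
qed

lemma Moebius_defect: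
  "(cmod (1 - cnj a * w))\<^sup>2 - (cmod (w - a))\<^sup>2 = (1 - (cmod a)\<^sup>2) * (1 - (cmod w)\<^sup>2)"
  unfolding cmod_power2 by (simp add: algebra_simps power2_eq_square)

text \<open>
  With \<open>a = f 0\<close>, the Schwarz lemma bounds the Moebius transform \<open>g = (f - a) / (1 - cnj a * f)\<close> by \<open>r = cmod z\<close>.
  The identity for its defect \<open>1 - (cmod g)\<^sup>2\<close> then bounds \<open>1 - (cmod f)\<^sup>2\<close> from below in terms of
  \<open>D = cmod (1 - cnj a * f)\<close>, and \<open>D \<ge> (1 - (cmod a)\<^sup>2) / (1 + r)\<close>.
\<close>

lemma one_minus_norm_square_lower_bound:
  assumes f: "f holomorphic_on ball 0 1" and f1: "\<And>w. cmod w < 1 \<Longrightarrow> cmod (f w) \<le> 1"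
    and z: "cmod z < 1"
  shows "(1 - (cmod (f 0))\<^sup>2) * (1 - cmod z) / (1 + cmod z) \<le> 1 - (cmod (f z))\<^sup>2"
proof (cases "cmod (f 0) = 1")
  case True
  then show ?thesis using f1[OF z] by (simp add: power_le_one)
next
  case False
  define a where "a = f 0"
  define A where "A = cmod a"
  define r where "r = cmod z"
  have A: "0 \<le> A" "A < 1" using f1[of 0] False by (auto simp: A_def a_def)
  have r: "0 \<le> r" "r < 1" using z by (auto simp: r_def)
  have nz: "1 - cnj a * f w \<noteq> 0" if "cmod w < 1" for w
    using A f1[OF that] by (intro one_minus_cnj_mult_nonzero) (auto simp: A_def)
  define g where "g w = (f w - a) / (1 - cnj a * f w)" for w
  have "cmod (g z) \<le> cmod z ^ 1"
  proof (rule Schwarz_lemma_order[OF _ _ _ z])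
    show "g holomorphic_on ball 0 1"
      unfolding g_def using nz by (intro holomorphic_intros f) auto
    show "cmod (g w) \<le> 1" if w: "cmod w < 1" for w
    proof -
      have "0 \<le> (1 - (cmod a)\<^sup>2) * (1 - (cmod (f w))\<^sup>2)"
        using A f1[OF w] by (intro mult_nonneg_nonneg) (auto simp: A_def power_le_one)
      then have "(cmod (f w - a))\<^sup>2 \<le> (cmod (1 - cnj a * f w))\<^sup>2"
        using Moebius_defect[of a "f w"] by linarith
      then have "cmod (f w - a) \<le> cmod (1 - cnj a * f w)"
        by (rule power2_le_imp_le) simp
      then show ?thesis using nz[OF w] by (simp add: g_def norm_divide)
    qed
  qed (simp add: g_def a_def)
  then have gr: "cmod (g z) \<le> r" by (simp add: r_def)
  define D where "D = cmod (1 - cnj a * f z)"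
  have "0 < D" using nz[OF z] by (simp add: D_def)
  have num: "cmod (f z - a) \<le> r * D"
    using gr \<open>0 < D\<close> by (simp add: g_def D_def norm_divide field_simps)
  have "(1 - A\<^sup>2) * (1 - (cmod (f z))\<^sup>2) = D\<^sup>2 - (cmod (f z - a))\<^sup>2"
    using Moebius_defect[of a "f z"] by (simp add: D_def A_def)
  also have "\<dots> \<ge> D\<^sup>2 - (r * D)\<^sup>2"
    using num by (simp add: power_mono)
  finally have 1: "(1 - r\<^sup>2) * D\<^sup>2 \<le> (1 - A\<^sup>2) * (1 - (cmod (f z))\<^sup>2)"
    by (simp add: algebra_simps power_mult_distrib)
  have "1 - A\<^sup>2 = cmod (1 - cnj a * a)"
  proof -
    have "1 - cnj a * a = complex_of_real (1 - A\<^sup>2)"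
      by (simp add: A_def of_real_cmod_square mult.commute)
    then show ?thesis using A by (simp only: norm_of_real) (simp add: power_le_one)
  qed
  also have "1 - cnj a * a = (1 - cnj a * f z) + cnj a * (f z - a)" by (simp add: algebra_simps)
  also have "cmod \<dots> \<le> D + A * (r * D)"
    unfolding D_def by (rule order_trans[OF norm_triangle_ineq add_left_mono])
      (use num A in \<open>auto simp: norm_mult A_def D_def intro: mult_left_mono\<close>)
  also have "\<dots> \<le> D * (1 + r)"
    using A r \<open>0 < D\<close> mult_right_mono[of A 1 "r * D"] by (simp add: algebra_simps)
  finally have "(1 - A\<^sup>2) / (1 + r) \<le> D" using r by (simp add: field_simps)
  moreover have pos: "0 < 1 - A\<^sup>2" using A by (simp add: abs_square_less_1)
  ultimately have "((1 - A\<^sup>2) / (1 + r))\<^sup>2 \<le> D\<^sup>2"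
    using r by (intro power_mono) auto
  then have "(1 - r\<^sup>2) * ((1 - A\<^sup>2) / (1 + r))\<^sup>2 \<le> (1 - r\<^sup>2) * D\<^sup>2"
    using r by (intro mult_left_mono) (auto simp: power_le_one)
  also note 1
  also have "(1 - r\<^sup>2) * ((1 - A\<^sup>2) / (1 + r))\<^sup>2 = (1 - A\<^sup>2) * ((1 - A\<^sup>2) * (1 - r) / (1 + r))"
  proof -
    have "1 - r\<^sup>2 = (1 - r) * (1 + r)" by (simp add: power2_eq_square algebra_simps)
    moreover have "1 + r \<noteq> 0" using r by linarith
    ultimately show ?thesis by (simp add: power_divide power2_eq_square)
  qed
  finally have "(1 - A\<^sup>2) * (1 - r) / (1 + r) \<le> 1 - (cmod (f z))\<^sup>2"
    by (simp only: mult_le_cancel_left_pos[OF pos])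
  then show ?thesis by (simp add: A_def a_def r_def)
qed

text \<open>
  Moving \<open>z\<close> to the origin by a Moebius map \<open>\<psi>\<close> gives \<open>f = g \<circ> \<psi>\<close>, where the first two coefficients of
  \<open>g\<close> are at most \<open>1 - (cmod (g 0))\<^sup>2\<close> and \<open>g 0 = f z\<close>. Since \<open>\<psi>' z = 1 / D\<close> and
  \<open>\<psi>'' z = 2 * cnj z / D\<^sup>2\<close> with \<open>D = 1 - (cmod z)\<^sup>2\<close>, the chain rule expresses the derivatives of \<open>f\<close> at
  \<open>z\<close> by these coefficients.
\<close>

theorem Schwarz_Pick_derivatives:
  assumes f: "f holomorphic_on ball 0 1" and f1: "\<And>w. cmod w < 1 \<Longrightarrow> cmod (f w) \<le> 1"
    and z: "cmod z < 1"
  shows "cmod (deriv f z) \<le> (1 - (cmod (f z))\<^sup>2) / (1 - (cmod z)\<^sup>2)"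
    and "cmod ((deriv ^^ 2) f z) / 2
      \<le> (1 - (cmod (f z))\<^sup>2) / ((1 - cmod z) * (1 - (cmod z)\<^sup>2))"
proof -
  define D where "D = 1 - (cmod z)\<^sup>2"
  have D: "0 < D" using z by (simp add: D_def abs_square_less_1)
  have Dz: "complex_of_real D = 1 - cnj z * z"
    by (simp add: D_def of_real_cmod_square mult.commute)
  define \<psi> where "\<psi> w = (w - z) / (1 - cnj z * w)" for w
  define \<phi> where "\<phi> w = (w + z) / (1 + cnj z * w)" for w
  have nz: "1 - cnj z * w \<noteq> 0" "1 + cnj z * w \<noteq> 0" if "cmod w < 1" for w
    using one_minus_cnj_mult_nonzero[OF z, of w] one_minus_cnj_mult_nonzero[OF z, of "- w"] that
    by auto
  have \<psi>1: "cmod (\<psi> w) < 1" and \<phi>1: "cmod (\<phi> w) < 1" if w: "cmod w < 1" for w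
    using Moebius_function_norm_lt_1[OF z w, of 0] Moebius_function_norm_lt_1[of "- z" w 0] z w
    by (simp_all add: Moebius_function_simple \<psi>_def \<phi>_def)
  have inv: "\<phi> (\<psi> w) = w" if w: "cmod w < 1" for w
    using Moebius_function_compose[of "- z" z w] z w
    by (simp add: Moebius_function_simple \<psi>_def \<phi>_def)
  define g where "g w = f (\<phi> w)" for w
  have g: "g holomorphic_on ball 0 1"
  proof -
    have "\<phi> holomorphic_on ball 0 1"
      unfolding \<phi>_def using nz by (intro holomorphic_intros) auto
    then have "f \<circ> \<phi> holomorphic_on ball 0 1"
      by (rule holomorphic_on_compose_gen[OF _ f]) (use \<phi>1 in auto)
    then show ?thesis by (simp add: o_def g_def[abs_def])
  qed
  have g0: "g 0 = f z" by (simp add: g_def \<phi>_def)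
  have dg: "(g has_field_derivative deriv g w) (at w)"
    "(deriv g has_field_derivative deriv (deriv g) w) (at w)" if "cmod w < 1" for w
    using that g holomorphic_deriv[OF g open_ball] by (auto intro!: holomorphic_derivI[OF _ open_ball])
  have f_eq: "f w = g (\<psi> w)" if "cmod w < 1" for w
    using inv[OF that] by (simp add: g_def)
  have d\<psi>: "(\<psi> has_field_derivative D / (1 - cnj z * w)\<^sup>2) (at w)" if "cmod w < 1" for w
    unfolding \<psi>_def using nz(1)[OF that]
    by (auto intro!: derivative_eq_intros simp: Dz power2_eq_square algebra_simps)
  have df: "deriv f w = deriv g (\<psi> w) * (D / (1 - cnj z * w)\<^sup>2)" if w: "cmod w < 1" for w
  proof -
    have "((\<lambda>w. g (\<psi> w)) has_field_derivative deriv g (\<psi> w) * (D / (1 - cnj z * w)\<^sup>2)) (at w)"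
      by (rule DERIV_chain2[OF dg(1)[OF \<psi>1[OF w]] d\<psi>[OF w]])
    then have "(f has_field_derivative deriv g (\<psi> w) * (D / (1 - cnj z * w)\<^sup>2)) (at w)"
      by (rule has_field_derivative_transform_within_open[of _ _ _ "ball 0 1"])
        (use w f_eq in auto)
    then show ?thesis by (rule DERIV_imp_deriv)
  qed
  have \<psi>z: "\<psi> z = 0" by (simp add: \<psi>_def)
  have c: "cmod (deriv g 0) \<le> 1 - (cmod (f z))\<^sup>2" "cmod ((deriv ^^ 2) g 0) / 2 \<le> 1 - (cmod (f z))\<^sup>2"
  proof -
    have "cmod (g w) \<le> 1" if "cmod w < 1" for w
      using f1[OF \<phi>1[OF that]] by (simp add: g_def)
    from taylor_coeff_bound[OF g this] show "cmod (deriv g 0) \<le> 1 - (cmod (f z))\<^sup>2"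
      "cmod ((deriv ^^ 2) g 0) / 2 \<le> 1 - (cmod (f z))\<^sup>2"
      by (simp_all add: taylor_coeff_def g0 norm_divide)
  qed
  have dfz: "deriv f z = deriv g 0 / D"
    using D by (simp add: df[OF z] \<psi>z flip: Dz) (simp add: power2_eq_square)
  then show "cmod (deriv f z) \<le> (1 - (cmod (f z))\<^sup>2) / (1 - (cmod z)\<^sup>2)"
    using c(1) D by (simp add: norm_divide divide_right_mono flip: D_def)
  have "((\<lambda>w. deriv g (\<psi> w) * (D / (1 - cnj z * w)\<^sup>2)) has_field_derivative
      deriv (deriv g) 0 / D\<^sup>2 + deriv g 0 * (2 * cnj z / D\<^sup>2)) (at z)"
  proof -
    have 1: "((\<lambda>w. deriv g (\<psi> w)) has_field_derivative deriv (deriv g) 0 * (D / (1 - cnj z * z)\<^sup>2)) (at z)"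
      using DERIV_chain2[OF dg(2)[OF \<psi>1[OF z]] d\<psi>[OF z]] by (simp add: \<psi>z)
    have 2: "((\<lambda>w. D / (1 - cnj z * w)\<^sup>2) has_field_derivative 2 * cnj z / D\<^sup>2) (at z)"
    proof -
      have "((\<lambda>w. D / (1 - cnj z * w)\<^sup>2) has_field_derivative
          D * (2 * cnj z * (1 - cnj z * z)) / ((1 - cnj z * z)\<^sup>2)\<^sup>2) (at z)"
        by (rule derivative_eq_intros refl | use nz(1)[OF z] in \<open>simp add: mult_ac power2_eq_square\<close>)+
      moreover have "D * (2 * cnj z * (1 - cnj z * z)) / ((1 - cnj z * z)\<^sup>2)\<^sup>2 = 2 * cnj z / D\<^sup>2"
        using D unfolding Dz[symmetric] by (simp add: power2_eq_square)
      ultimately show ?thesis by metis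
    qed
    have eq: "deriv (deriv g) 0 * (D / (1 - cnj z * z)\<^sup>2) * (D / (1 - cnj z * z)\<^sup>2)
        + 2 * cnj z / D\<^sup>2 * deriv g (\<psi> z)
      = deriv (deriv g) 0 / D\<^sup>2 + deriv g 0 * (2 * cnj z / D\<^sup>2)"
      using D unfolding Dz[symmetric] \<psi>z by (simp add: power2_eq_square)
    show ?thesis using DERIV_mult[OF 1 2] unfolding eq .
  qed
  then have "(deriv f has_field_derivative
      deriv (deriv g) 0 / D\<^sup>2 + deriv g 0 * (2 * cnj z / D\<^sup>2)) (at z)"
    by (rule has_field_derivative_transform_within_open[of _ _ _ "ball 0 1"])
      (use z df in auto)
  then have "(deriv ^^ 2) f z = (deriv (deriv g) 0 + 2 * cnj z * deriv g 0) / D\<^sup>2"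
    by (simp add: DERIV_imp_deriv numeral_2_eq_2 add_divide_distrib mult_ac)
  then have "cmod ((deriv ^^ 2) f z) / 2 = cmod (deriv (deriv g) 0 + 2 * cnj z * deriv g 0) / 2 / D\<^sup>2"
    by (simp add: norm_divide norm_power D_def[symmetric] del: of_real_power)
  also have "\<dots> \<le> (1 - (cmod (f z))\<^sup>2) * (1 + cmod z) / D\<^sup>2"
  proof (rule divide_right_mono)
    have "cmod (deriv (deriv g) 0 + 2 * cnj z * deriv g 0)
        \<le> cmod (deriv (deriv g) 0) + 2 * (cmod z * cmod (deriv g 0))"
      using norm_triangle_ineq[of "deriv (deriv g) 0" "2 * cnj z * deriv g 0"]
      by (simp add: norm_mult)
    moreover have funpow_2: "(deriv ^^ 2) g 0 = deriv (deriv g) 0" by (simp add: numeral_2_eq_2)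
    moreover have "cmod z * cmod (deriv g 0) \<le> cmod z * (1 - (cmod (f z))\<^sup>2)"
      using c(1) by (rule mult_left_mono) simp
    ultimately show "cmod (deriv (deriv g) 0 + 2 * cnj z * deriv g 0) / 2
        \<le> (1 - (cmod (f z))\<^sup>2) * (1 + cmod z)"
      using c(2) unfolding distrib_left by (simp add: funpow_2 mult.commute)
  qed simp
  also have "\<dots> = (1 - (cmod (f z))\<^sup>2) / ((1 - cmod z) * (1 - (cmod z)\<^sup>2))"
  proof -
    have cancel: "u * q / (p * q)\<^sup>2 = u / (p * (p * q))" if "q \<noteq> 0" for u p q :: real
      using that by (simp add: power2_eq_square)
    have "D = (1 - cmod z) * (1 + cmod z)" by (simp add: D_def algebra_simps power2_eq_square)
    moreover have "1 + cmod z \<noteq> 0" using norm_ge_zero[of z] by linarith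
    ultimately show ?thesis
      using cancel[of "1 + cmod z" "1 - (cmod (f z))\<^sup>2" "1 - cmod z"]
      unfolding D_def[symmetric] by metis
  qed
  finally show "cmod ((deriv ^^ 2) f z) / 2
      \<le> (1 - (cmod (f z))\<^sup>2) / ((1 - cmod z) * (1 - (cmod z)\<^sup>2))" .
qed

section \<open>Mappings of the unit ball restricted to complex lines\<close>

lemma norm_scaleC_sgn: "cmod \<zeta> < 1 \<Longrightarrow> norm (\<zeta> *\<^sub>C sgn (x::'a::complex_banach)) < 1"
  by (simp add: norm_scaleC norm_sgn)

lemma scaleC_norm_sgn: "complex_of_real (norm x) *\<^sub>C sgn x = (x::'a::complex_banach)"
  by (cases "x = 0") (simp_all add: scaleC_of_real sgn_div_norm)

text \<open>
  The scalar Schwarz lemma for \<open>\<zeta> \<mapsto> l (\<mu> (\<zeta> *\<^sub>C sgn z))\<close>, uniformly in the functional \<open>l\<close>.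
\<close>

lemma Schwarz_mapping_bound:
  fixes \<mu> :: "'a::complex_banach \<Rightarrow> 'a"
  assumes \<mu>: "schwarz_mapping \<mu>" and zero: "zero_of_order k \<mu>" and z: "norm z < 1"
  shows "norm (\<mu> z) \<le> norm z ^ k"
proof (rule norm_le_of_functionals)
  fix l :: "'a \<Rightarrow> complex"
  assume l: "bounded_clinear l" and l1: "\<And>x. cmod (l x) \<le> norm x"
  have hol: "holomorphic_map \<mu> (ball 0 1)" and into: "\<And>x. norm x < 1 \<Longrightarrow> norm (\<mu> x) < 1"
    using \<mu> by (auto simp: schwarz_mapping_def image_subset_iff)
  define \<phi> where "\<phi> \<zeta> = l (\<mu> (0 + \<zeta> *\<^sub>C sgn z))" for \<zeta>
  have "cmod (\<phi> (norm z)) \<le> cmod (norm z) ^ k"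
  proof (rule Schwarz_lemma_order)
    show "\<phi> holomorphic_on ball 0 1"
      unfolding \<phi>_def by (rule holomorphic_on_subset[OF holomorphic_on_line[OF hol l]])
        (auto simp: norm_scaleC_sgn)
    show "cmod (\<phi> w) \<le> 1" if "cmod w < 1" for w
      using l1[of "\<mu> (w *\<^sub>C sgn z)"] into[OF norm_scaleC_sgn[OF that, of z]] by (simp add: \<phi>_def)
    show "(deriv ^^ j) \<phi> 0 = 0" if "j < k" for j
    proof -
      have "(deriv ^^ j) \<phi> 0 = l (frechet_deriv j \<mu> (0 + 0 *\<^sub>C sgn z) (replicate j (sgn z)))"
        unfolding \<phi>_def by (rule higher_deriv_along_line[OF hol l]) simp
      also have "\<dots> = l 0" using zero that by (simp add: zero_of_order_def)
      also have "l 0 = 0" using bounded_clinear_scaleR[OF l, of 0] by simp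
      finally show ?thesis .
    qed
  qed (use z in simp)
  then show "cmod (l (\<mu> z)) \<le> norm z ^ k" by (simp add: \<phi>_def scaleC_norm_sgn)
qed

text \<open>
  The direction is \<open>sgn w\<close>, of norm at most one, so that \<open>w = 0\<close> needs no separate treatment: the
  slice is then constant.
\<close>

definition slice :: "('a::complex_banach \<Rightarrow> complex) \<Rightarrow> 'a \<Rightarrow> complex \<Rightarrow> complex" where
  "slice F w \<zeta> = F (\<zeta> *\<^sub>C sgn w)"

lemma slice_0 [simp]: "slice F w 0 = F 0"
  by (simp add: slice_def)

lemma slice_norm [simp]: "slice F w (complex_of_real (norm w)) = F w"
  by (simp add: slice_def scaleC_norm_sgn)

lemma bounded_clinear_ident: "bounded_clinear (\<lambda>x::'a::complex_banach. x)"
  by (simp add: bounded_clinear_def)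

lemma slice_holomorphic:
  assumes "holomorphic_map F (ball 0 1)"
  shows "slice F w holomorphic_on ball 0 1"
proof -
  have "(\<lambda>\<zeta>. F (0 + \<zeta> *\<^sub>C sgn w)) holomorphic_on ball 0 1"
    by (rule holomorphic_on_subset[OF holomorphic_on_line[OF assms bounded_clinear_ident]])
      (auto simp: norm_scaleC_sgn)
  then show ?thesis by (simp add: slice_def[abs_def])
qed

lemma slice_bounded:
  assumes "F ` ball 0 1 \<subseteq> closure (ball 0 1)" and "cmod \<zeta> < 1"
  shows "cmod (slice F w \<zeta>) \<le> 1"
  using assms(1) norm_scaleC_sgn[OF assms(2), of w] by (auto simp: slice_def image_subset_iff)

text \<open>
  For \<open>\<zeta> = 1\<close> this gives the derivatives at \<open>w\<close> itself, for \<open>\<zeta> = 0\<close> the Taylor polynomials.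
\<close>

lemma frechet_deriv_slice:
  assumes F: "holomorphic_map F (ball 0 1)" and z: "norm (\<zeta> *\<^sub>C w) < 1"
  shows "frechet_deriv n F (\<zeta> *\<^sub>C w) (replicate n w)
    = complex_of_real (norm w) ^ n * (deriv ^^ n) (slice F w) (complex_of_real (norm w) * \<zeta>)"
proof -
  let ?S = "{\<zeta>. 0 + \<zeta> *\<^sub>C w \<in> ball 0 1}"
  have "open ?S" by (rule open_line_preimage) simp
  have eq: "F (0 + \<zeta> *\<^sub>C w) = slice F w (complex_of_real (norm w) * \<zeta>)" for \<zeta>
  proof -
    have "(complex_of_real (norm w) * \<zeta>) *\<^sub>C sgn w = \<zeta> *\<^sub>C complex_of_real (norm w) *\<^sub>C sgn w"
      by (simp only: scaleC_scaleC mult.commute)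
    then show ?thesis by (simp add: slice_def scaleC_norm_sgn)
  qed
  have "frechet_deriv n F (0 + \<zeta> *\<^sub>C w) (replicate n w) = (deriv ^^ n) (\<lambda>\<zeta>. F (0 + \<zeta> *\<^sub>C w)) \<zeta>"
    using higher_deriv_along_line[OF F bounded_clinear_ident, of 0 \<zeta> w n] z by simp
  also have "\<dots> = complex_of_real (norm w) ^ n * (deriv ^^ n) (slice F w) (complex_of_real (norm w) * \<zeta>)"
    unfolding eq
    by (rule higher_deriv_compose_linear[OF slice_holomorphic[OF F] \<open>open ?S\<close> open_ball])
      (use z in \<open>auto simp: norm_scaleC norm_mult mult.commute\<close>)
  finally show ?thesis by simp
qed

lemma taylor_poly_slice:
  assumes F: "holomorphic_map F (ball 0 1)"
  shows "taylor_poly F n w = complex_of_real (norm w) ^ n * taylor_coeff (slice F w) n"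
  using frechet_deriv_slice[OF F, of 0 w n] by (simp add: taylor_poly_def taylor_coeff_def)

section \<open>The two parts of the Bohr functional\<close>

text \<open>
  The sum \<open>t / (1 - t\<^sup>2) + t\<^sup>2 / ((1 - t) * (1 - t\<^sup>2))\<close> of the Schwarz--Pick factors of the first and the
  second derivative term.
\<close>

definition derivative_weight :: "real \<Rightarrow> real" where
  "derivative_weight t = t / ((1 - t) * (1 - t\<^sup>2))"

lemma derivative_part_le:
  fixes F :: "'a::complex_banach \<Rightarrow> complex"
  assumes F: "holomorphic_map F (ball 0 1)" "F ` ball 0 1 \<subseteq> closure (ball 0 1)"
    and w: "norm w < 1"
  shows "(cmod (F w))\<^sup>2 + cmod (frechet_deriv 1 F w [w]) + 1 / fact 2 * cmod (frechet_deriv 2 F w [w, w])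
      \<le> 1 - (1 - (cmod (F w))\<^sup>2) * (1 - derivative_weight (norm w))"
    and "(1 - (cmod (F 0))\<^sup>2) * (1 - norm w) / (1 + norm w) \<le> 1 - (cmod (F w))\<^sup>2"
    and "cmod (F w) \<le> 1"
proof -
  define t where "t = norm w"
  define f where "f = slice F w"
  define u where "u = 1 - (cmod (F w))\<^sup>2"
  have t: "0 \<le> t" "t < 1" using w by (auto simp: t_def)
  have f: "f holomorphic_on ball 0 1" "\<And>\<zeta>. cmod \<zeta> < 1 \<Longrightarrow> cmod (f \<zeta>) \<le> 1"
    using slice_holomorphic[OF F(1)] slice_bounded[OF F(2)] by (auto simp: f_def)
  have ft: "f (complex_of_real t) = F w" "f 0 = F 0" by (simp_all add: f_def t_def)
  have ct: "cmod (complex_of_real t) = t" using t by simp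
  show "(1 - (cmod (F 0))\<^sup>2) * (1 - norm w) / (1 + norm w) \<le> 1 - (cmod (F w))\<^sup>2"
    using one_minus_norm_square_lower_bound[OF f, of "complex_of_real t"] t ft ct by (simp add: t_def)
  show "cmod (F w) \<le> 1" using f(2)[of "complex_of_real t"] t ft by simp
  have D: "frechet_deriv n F w (replicate n w) = complex_of_real t ^ n * (deriv ^^ n) f (complex_of_real t)" for n
    using frechet_deriv_slice[OF F(1), of 1 w n] w by (simp add: f_def t_def)
  have "cmod (frechet_deriv 1 F w [w]) = t * cmod (deriv f (complex_of_real t))"
    using D[of 1] t by (simp add: norm_mult)
  also have "\<dots> \<le> t * (u / (1 - t\<^sup>2))"
    using Schwarz_Pick_derivatives(1)[OF f, of "complex_of_real t"] t ft ct
    by (intro mult_left_mono) (simp_all add: u_def)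
  finally have 1: "cmod (frechet_deriv 1 F w [w]) \<le> t * (u / (1 - t\<^sup>2))" .
  have "cmod (frechet_deriv 2 F w [w, w]) / 2 = t\<^sup>2 * (cmod ((deriv ^^ 2) f (complex_of_real t)) / 2)"
    using D[of 2] t by (simp add: norm_mult norm_power numeral_2_eq_2)
  also have "\<dots> \<le> t\<^sup>2 * (u / ((1 - t) * (1 - t\<^sup>2)))"
    using Schwarz_Pick_derivatives(2)[OF f, of "complex_of_real t"] t ft ct
    by (intro mult_left_mono) (simp_all add: u_def)
  finally have 2: "cmod (frechet_deriv 2 F w [w, w]) / 2 \<le> t\<^sup>2 * (u / ((1 - t) * (1 - t\<^sup>2)))" .
  have "t * (u / (1 - t\<^sup>2)) + t\<^sup>2 * (u / ((1 - t) * (1 - t\<^sup>2))) = u * derivative_weight t"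
  proof -
    have gen: "t * (u / q) + t\<^sup>2 * (u / ((1 - t) * q)) = u * (t / ((1 - t) * q))" if "q \<noteq> 0" for q
      using that t by (simp add: divide_simps) (simp add: algebra_simps power2_eq_square)
    have "1 - t\<^sup>2 \<noteq> 0" using t abs_square_less_1[of t] by simp
    from gen[OF this] show ?thesis by (simp add: derivative_weight_def)
  qed
  then have "u * (1 - derivative_weight t) = u - (t * (u / (1 - t\<^sup>2)) + t\<^sup>2 * (u / ((1 - t) * (1 - t\<^sup>2))))"
    by (simp add: right_diff_distrib)
  moreover have "1 / fact 2 * cmod (frechet_deriv 2 F w [w, w]) = cmod (frechet_deriv 2 F w [w, w]) / 2"
    by simp
  moreover have "(cmod (F w))\<^sup>2 = 1 - u" by (simp add: u_def)
  ultimately show "(cmod (F w))\<^sup>2 + cmod (frechet_deriv 1 F w [w]) + 1 / fact 2 * cmod (frechet_deriv 2 F w [w, w])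
      \<le> 1 - (1 - (cmod (F w))\<^sup>2) * (1 - derivative_weight (norm w))"
    using 1 2 unfolding u_def[symmetric] t_def[symmetric] by linarith
qed

text \<open>
  The Taylor polynomials are homogeneous, so their values at \<open>w\<close> only grow when the factor
  \<open>norm w ^ n\<close> is replaced by \<open>x ^ n\<close>.
\<close>

lemma coefficient_part_le:
  fixes F :: "'a::complex_banach \<Rightarrow> complex"
  assumes F: "holomorphic_map F (ball 0 1)" "F ` ball 0 1 \<subseteq> closure (ball 0 1)"
    and w: "norm w \<le> x" and x: "x < 1"
  shows "summable (\<lambda>j. cmod (taylor_poly F (j + 3) w))"
    and "summable (\<lambda>j. (cmod (taylor_poly F (j + 2) w))\<^sup>2)"
    and "(\<Sum>j. cmod (taylor_poly F (j + 3) w)) + (cmod (taylor_poly F 1 w))\<^sup>2 * x / (1 - x)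
        + (1 / (1 + cmod (F 0)) + x / (1 - x)) * (\<Sum>j. (cmod (taylor_poly F (j + 2) w))\<^sup>2)
      \<le> (1 - (cmod (F 0))\<^sup>2) * x ^ 3 / (1 - x)"
proof -
  define f where "f = slice F w"
  define b where "b n = cmod (taylor_coeff f n)" for n
  have f: "f holomorphic_on ball 0 1" "\<And>\<zeta>. cmod \<zeta> < 1 \<Longrightarrow> cmod (f \<zeta>) \<le> 1"
    using slice_holomorphic[OF F(1)] slice_bounded[OF F(2)] by (auto simp: f_def)
  have x0: "0 \<le> x" using w norm_ge_zero[of w] by linarith
  have b0: "b 0 = cmod (F 0)" by (simp add: b_def f_def)
  have odd: "b (2 * n + 1) \<le> 1 - (\<Sum>i\<le>n. (b i)\<^sup>2)" for n
    unfolding b_def by (rule Carlson_odd[OF f])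
  have even: "b (2 * n) \<le> 1 - (\<Sum>i<n. (b i)\<^sup>2) - (b n)\<^sup>2 / (1 + b 0)" if "0 < n" for n
    unfolding b_def by (rule Carlson_even[OF f that])
  have b_nonneg: "0 \<le> b n" for n by (simp add: b_def)
  have bohr: "summable (\<lambda>j. b (j + 3) * x ^ (j + 3))"
    "summable (\<lambda>j. (b (j + 2) * x ^ (j + 2))\<^sup>2)"
    "(\<Sum>j. b (j + 3) * x ^ (j + 3)) + (b 1)\<^sup>2 * x ^ 3 / (1 - x)
      + (1 / (1 + b 0) + x / (1 - x)) * (\<Sum>j. (b (j + 2) * x ^ (j + 2))\<^sup>2)
    \<le> (1 - (b 0)\<^sup>2) * x ^ 3 / (1 - x)"
    by (rule refined_Bohr_sum[OF x0 x b_nonneg odd even], assumption)+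
  have P: "cmod (taylor_poly F n w) \<le> b n * x ^ n" for n
  proof -
    have "cmod (taylor_poly F n w) = norm w ^ n * b n"
      by (simp add: taylor_poly_slice[OF F(1)] b_def f_def norm_mult norm_power)
    also have "\<dots> \<le> x ^ n * b n"
      using w by (intro mult_right_mono power_mono) (auto simp: b_def)
    finally show ?thesis by (simp add: mult.commute)
  qed
  have P2: "(cmod (taylor_poly F n w))\<^sup>2 \<le> (b n * x ^ n)\<^sup>2" for n
    using P by (rule power_mono) simp
  show s1: "summable (\<lambda>j. cmod (taylor_poly F (j + 3) w))"
    by (rule summable_comparison_test'[OF bohr(1)]) (unfold real_norm_def abs_norm_cancel, rule P)
  show s2: "summable (\<lambda>j. (cmod (taylor_poly F (j + 2) w))\<^sup>2)"
    by (rule summable_comparison_test'[OF bohr(2)]) (unfold real_norm_def abs_power2, rule P2)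
  have "(\<Sum>j. cmod (taylor_poly F (j + 3) w)) \<le> (\<Sum>j. b (j + 3) * x ^ (j + 3))"
    by (rule suminf_le[OF P s1 bohr(1)])
  moreover have "(cmod (taylor_poly F 1 w))\<^sup>2 * x / (1 - x) \<le> (b 1)\<^sup>2 * x ^ 3 / (1 - x)"
  proof (rule divide_right_mono)
    have "(cmod (taylor_poly F 1 w))\<^sup>2 * x \<le> (b 1 * x ^ 1)\<^sup>2 * x"
      using P2 x0 by (rule mult_right_mono)
    also have "\<dots> = (b 1)\<^sup>2 * x ^ 3" by (simp add: power2_eq_square power3_eq_cube)
    finally show "(cmod (taylor_poly F 1 w))\<^sup>2 * x \<le> (b 1)\<^sup>2 * x ^ 3" .
  qed (use x in simp)
  moreover have "(1 / (1 + b 0) + x / (1 - x)) * (\<Sum>j. (cmod (taylor_poly F (j + 2) w))\<^sup>2)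
      \<le> (1 / (1 + b 0) + x / (1 - x)) * (\<Sum>j. (b (j + 2) * x ^ (j + 2))\<^sup>2)"
    using x0 x by (intro mult_left_mono suminf_le[OF P2 s2 bohr(2)]) (simp add: b_def)
  ultimately show "(\<Sum>j. cmod (taylor_poly F (j + 3) w)) + (cmod (taylor_poly F 1 w))\<^sup>2 * x / (1 - x)
        + (1 / (1 + cmod (F 0)) + x / (1 - x)) * (\<Sum>j. (cmod (taylor_poly F (j + 2) w))\<^sup>2)
      \<le> (1 - (cmod (F 0))\<^sup>2) * x ^ 3 / (1 - x)"
    using bohr(3) unfolding b0 by linarith
qed

theorem bohr_functional_bounds:
  fixes F :: "'a::complex_banach \<Rightarrow> complex" and \<mu>k \<mu>m :: "'a \<Rightarrow> 'a"
  assumes F: "holomorphic_map F (ball 0 1)" "F ` ball 0 1 \<subseteq> closure (ball 0 1)"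
    and k: "norm (\<mu>k z) \<le> r ^ k" "r ^ k < 1" and m: "norm (\<mu>m z) < 1"
  shows "bohr_summable F \<mu>k z"
    and "(cmod (F (\<mu>m z)))\<^sup>2 \<le> bohr_functional k \<mu>k \<mu>m F z r"
    and "bohr_functional k \<mu>k \<mu>m F z r
      \<le> 1 - (1 - (cmod (F (\<mu>m z)))\<^sup>2) * (1 - derivative_weight (norm (\<mu>m z)))
        + (1 - (cmod (F 0))\<^sup>2) * (r ^ k) ^ 3 / (1 - r ^ k)"
proof -
  note coeff = coefficient_part_le[OF F k]
  show "bohr_summable F \<mu>k z" using coeff(1,2) by (simp add: bohr_summable_def)
  have "0 \<le> r ^ k" using k(1) norm_ge_zero[of "\<mu>k z"] by linarith
  then have "0 \<le> (1 / (1 + cmod (F 0)) + r ^ k / (1 - r ^ k))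
      * (\<Sum>j. (cmod (taylor_poly F (j + 2) (\<mu>k z)))\<^sup>2)"
    using k(2) coeff(2) by (intro mult_nonneg_nonneg add_nonneg_nonneg suminf_nonneg) auto
  moreover have "0 \<le> (cmod (taylor_poly F 1 (\<mu>k z)))\<^sup>2 * r ^ k / (1 - r ^ k)"
    using k(2) \<open>0 \<le> r ^ k\<close> by simp
  moreover have "0 \<le> (\<Sum>j. cmod (taylor_poly F (j + 3) (\<mu>k z)))"
    by (rule suminf_nonneg[OF coeff(1)]) simp
  moreover have "0 \<le> cmod (frechet_deriv 1 F (\<mu>m z) [\<mu>m z])
      + 1 / fact 2 * cmod (frechet_deriv 2 F (\<mu>m z) [\<mu>m z, \<mu>m z])"
    by simp
  ultimately show "(cmod (F (\<mu>m z)))\<^sup>2 \<le> bohr_functional k \<mu>k \<mu>m F z r"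
    unfolding bohr_functional_def by linarith
  show "bohr_functional k \<mu>k \<mu>m F z r
      \<le> 1 - (1 - (cmod (F (\<mu>m z)))\<^sup>2) * (1 - derivative_weight (norm (\<mu>m z)))
        + (1 - (cmod (F 0))\<^sup>2) * (r ^ k) ^ 3 / (1 - r ^ k)"
    using derivative_part_le(1)[OF F m] coeff(3) unfolding bohr_functional_def by linarith
qed

section \<open>The radii\<close>

definition R2k_fun :: "nat \<Rightarrow> nat \<Rightarrow> real \<Rightarrow> real" where
  "R2k_fun m k r = (1 - r ^ k) * (-1 + 2 * r ^ m + r ^ (2 * m) - r ^ (3 * m))
      + r ^ (3 * k) * (1 - r ^ m) * (1 + r ^ m)\<^sup>2"

lemma R2k_equation_iff: "R2k_equation m k r \<longleftrightarrow> R2k_fun m k r = 0"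
  by (simp add: R2k_equation_def R2k_fun_def)

text \<open>
  The difference of the two sides is \<open>(y' - y) * (2 + (y + y') - (y * y + y * y' + y' * y'))\<close>.
\<close>

lemma R2_cubic_strict_decreasing:
  fixes y y' :: real
  assumes "0 \<le> y" "y < y'" "y' \<le> 1"
  shows "y' ^ 3 - y'\<^sup>2 - 2 * y' + 1 < y ^ 3 - y\<^sup>2 - 2 * y + 1"
proof -
  have "y * y \<le> y" "y' * y' \<le> y'" "y * y' \<le> 1"
    using assms mult_left_le[of y y] mult_left_le[of y' y'] mult_le_one[of y y'] by auto
  then have "0 < 2 + (y + y') - (y * y + y * y' + y' * y')" by linarith
  then have "0 < (y' - y) * (2 + (y + y') - (y * y + y * y' + y' * y'))"
    using assms by simp
  then show ?thesis by (simp add: algebra_simps power2_eq_square power3_eq_cube)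
qed

lemma R2_unique_root:
  assumes m: "1 \<le> m"
  shows "{r. 0 < r \<and> r < 1 \<and> R2_equation m r} = {R2 m}"
proof -
  define p :: "real \<Rightarrow> real" where "p r = r ^ (3 * m) - r ^ (2 * m) - 2 * r ^ m + 1" for r
  have p_cubic: "p r = (r ^ m) ^ 3 - (r ^ m)\<^sup>2 - 2 * r ^ m + 1" for r
    by (simp add: p_def mult.commute flip: power_mult)
  have eq: "R2_equation m r \<longleftrightarrow> p r = 0" for r by (simp add: R2_equation_def p_def)
  have "\<exists>r\<ge>0. r \<le> 1 \<and> p r = 0"
    by (rule IVT2') (use m in \<open>auto simp: p_def power_0_left intro!: continuous_intros\<close>)
  then obtain r where r: "0 \<le> r" "r \<le> 1" "p r = 0" by blast
  moreover have "p 0 \<noteq> 0" "p 1 \<noteq> 0" using m by (auto simp: p_def power_0_left)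
  ultimately have r': "0 < r \<and> r < 1 \<and> R2_equation m r"
    using eq by (metis order_le_less)
  have less: "p s' < p s" if "0 < s" "s < s'" "s' < 1" for s s'
    unfolding p_cubic using that m
    by (intro R2_cubic_strict_decreasing) (auto simp: power_strict_mono power_le_one)
  have unique: "s = r" if "0 < s \<and> s < 1 \<and> R2_equation m s" for s
    using less[of s r] less[of r s] that r' r(3) by (force simp: eq neq_iff)
  have "R2 m = r"
    unfolding R2_def using r' unique by (rule the_equality)
  then show ?thesis using r' unique by blast
qed

text \<open>
  At \<open>r = R2 m\<close> the first summand of \<open>R2k_fun\<close> vanishes and the second is nonnegative, while the value
  at zero is \<open>-1\<close>. So there is a root in \<open>{0<..R2 m}\<close>, and by compactness a least one, before which the
  function is negative. This keeps the least root away from \<open>1\<close>, which is always a root.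
\<close>

lemma R2k_least_root:
  assumes m: "1 \<le> m" and k: "1 \<le> k"
  shows "0 < R2k m k" and "R2k m k < 1" and "R2k_equation m k (R2k m k)"
    and "\<And>r. 0 < r \<Longrightarrow> R2k_equation m k r \<Longrightarrow> R2k m k \<le> r"
    and "\<And>r. 0 \<le> r \<Longrightarrow> r \<le> R2k m k \<Longrightarrow> R2k_fun m k r \<le> 0"
proof -
  define P where "P = R2k_fun m k"
  define s where "s = R2 m"
  have s: "0 < s" "s < 1" "R2_equation m s"
    using R2_unique_root[OF m] unfolding s_def by auto
  have P0: "P 0 = -1" using m k by (simp add: P_def R2k_fun_def power_0_left)
  have cont: "continuous_on A P" for A
    unfolding P_def R2k_fun_def by (intro continuous_intros)
  have "0 \<le> P s"
  proof -
    have "-1 + 2 * s ^ m + s ^ (2 * m) - s ^ (3 * m) = 0"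
      using s(3) by (simp add: R2_equation_def)
    then have "P s = s ^ (3 * k) * (1 - s ^ m) * (1 + s ^ m)\<^sup>2"
      by (simp add: P_def R2k_fun_def)
    also have "\<dots> \<ge> 0" using s by (simp add: power_le_one)
    finally show ?thesis .
  qed
  have root: "\<exists>x. 0 \<le> x \<and> x \<le> y \<and> P x = 0" if "0 \<le> y" "0 \<le> P y" for y
    by (rule IVT') (use that P0 cont in auto)
  define K where "K = {0..s} \<inter> P -` {0}"
  have "compact K"
    unfolding K_def using cont
    by (intro compact_Int_closed closed_vimage) (auto simp: continuous_on_eq_continuous_within)
  moreover have "K \<noteq> {}"
    using root[of s] s \<open>0 \<le> P s\<close> by (auto simp: K_def)
  ultimately obtain r0 where r0: "r0 \<in> K" "\<And>r. r \<in> K \<Longrightarrow> r0 \<le> r"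
    using compact_attains_inf[of K] by blast
  have "r0 \<noteq> 0" using r0(1) P0 by (auto simp: K_def)
  then have r0': "0 < r0" "r0 \<le> s" "P r0 = 0" using r0(1) by (auto simp: K_def)
  have least: "r0 \<le> r" if "0 < r" "P r = 0" for r
    using r0(2)[of r] that r0'(2) by (cases "r \<le> s") (auto simp: K_def)
  have R2k: "R2k m k = r0"
    unfolding R2k_def R2k_equation_iff
    by (rule Least_equality) (use r0' least in \<open>auto simp: P_def\<close>)
  show "0 < R2k m k" "R2k m k < 1" "R2k_equation m k (R2k m k)"
    using r0' s by (auto simp: R2k R2k_equation_iff P_def)
  show "R2k m k \<le> r" if "0 < r" "R2k_equation m k r" for r
    using least that by (simp add: R2k R2k_equation_iff P_def)
  show "R2k_fun m k r \<le> 0" if r: "0 \<le> r" "r \<le> R2k m k" for r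
  proof (rule ccontr)
    assume "\<not> R2k_fun m k r \<le> 0"
    then have "0 < P r" by (simp add: P_def)
    with root[of r] r obtain x where x: "0 \<le> x" "x \<le> r" "P x = 0" by auto
    have "x \<noteq> 0" using x P0 by auto
    then have "r0 \<le> x" using least x by simp
    then have "r = r0" using x r R2k by simp
    then show False using \<open>0 < P r\<close> r0'(3) by simp
  qed
qed

lemma derivative_weight_mono:
  assumes "0 \<le> t" "t \<le> \<rho>" "\<rho> < 1"
  shows "derivative_weight t \<le> derivative_weight \<rho>"
  unfolding derivative_weight_def
proof (rule frac_le)
  have "\<rho>\<^sup>2 < 1" using assms by (simp add: abs_square_less_1)
  moreover have "t\<^sup>2 \<le> \<rho>\<^sup>2" using assms by (intro power_mono) auto
  ultimately show "(1 - \<rho>) * (1 - \<rho>\<^sup>2) \<le> (1 - t) * (1 - t\<^sup>2)"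
    "0 < (1 - \<rho>) * (1 - \<rho>\<^sup>2)"
    using assms by (auto intro!: mult_mono)
qed (use assms in auto)

text \<open>
  With \<open>Q = 1 - 2 * \<rho> - \<rho>\<^sup>2 + \<rho> ^ 3\<close> the right-hand side for \<open>t = \<rho>\<close> equals \<open>Q / ((1 - \<rho>) * (1 + \<rho>)\<^sup>2)\<close>, so that
  the claim is \<open>R2k_fun m k r \<le> 0\<close> with the denominators cleared. Both factors on the right decrease
  in \<open>t\<close>.
\<close>

lemma R2k_fun_nonpos_imp:
  assumes r: "0 \<le> r" "r ^ m < 1" "r ^ k < 1" and neg: "R2k_fun m k r \<le> 0"
    and t: "0 \<le> t" "t \<le> r ^ m"
  shows "derivative_weight t \<le> 1"
    and "(r ^ k) ^ 3 / (1 - r ^ k) \<le> (1 - t) / (1 + t) * (1 - derivative_weight t)"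
proof -
  define \<rho> where "\<rho> = r ^ m"
  define x where "x = r ^ k"
  define Q where "Q = 1 - 2 * \<rho> - \<rho>\<^sup>2 + \<rho> ^ 3"
  have \<rho>: "0 \<le> \<rho>" "\<rho> < 1" and x: "0 \<le> x" "x < 1" using r by (auto simp: \<rho>_def x_def)
  have "\<rho>\<^sup>2 < 1" using \<rho> by (simp add: abs_square_less_1)
  have main: "x ^ 3 * ((1 - \<rho>) * (1 + \<rho>)\<^sup>2) \<le> (1 - x) * Q"
    using neg by (simp add: R2k_fun_def \<rho>_def x_def Q_def power_mult[symmetric] mult.commute algebra_simps)
  have "0 \<le> x ^ 3 * ((1 - \<rho>) * (1 + \<rho>)\<^sup>2)" using x \<rho> by simp
  then have "0 \<le> (1 - x) * Q" using main by linarith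
  then have "0 \<le> Q" using x by (simp add: zero_le_mult_iff)
  have "(1 - \<rho>) * (1 - \<rho>\<^sup>2) - \<rho> = Q" by (simp add: Q_def algebra_simps power2_eq_square power3_eq_cube)
  have "0 < (1 - \<rho>) * (1 - \<rho>\<^sup>2)" using \<rho> \<open>\<rho>\<^sup>2 < 1\<close> by simp
  then have weight: "1 - derivative_weight \<rho> = Q / ((1 - \<rho>) * (1 - \<rho>\<^sup>2))"
    unfolding derivative_weight_def \<open>(1 - \<rho>) * (1 - \<rho>\<^sup>2) - \<rho> = Q\<close>[symmetric] diff_divide_distrib
    by (simp only: divide_self[OF less_imp_neq[THEN not_sym]])
  then have weight1: "derivative_weight \<rho> \<le> 1"
    using \<open>0 \<le> Q\<close> \<open>0 < (1 - \<rho>) * (1 - \<rho>\<^sup>2)\<close> divide_nonneg_pos[of Q "(1 - \<rho>) * (1 - \<rho>\<^sup>2)"] by linarith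
  have mono: "derivative_weight t \<le> derivative_weight \<rho>"
    using t \<rho> by (intro derivative_weight_mono) (auto simp: \<rho>_def)
  then show "derivative_weight t \<le> 1" using weight1 by simp
  have "x ^ 3 / (1 - x) \<le> Q / ((1 - \<rho>) * (1 + \<rho>)\<^sup>2)"
    using main x \<rho> by (simp add: divide_le_eq le_divide_eq mult.commute mult.left_commute)
  also have "\<dots> = (1 - \<rho>) / (1 + \<rho>) * (1 - derivative_weight \<rho>)"
  proof -
    have "1 - \<rho>\<^sup>2 = (1 - \<rho>) * (1 + \<rho>)" by (simp add: algebra_simps power2_eq_square)
    then show ?thesis using \<rho> by (simp add: weight power2_eq_square)
  qed
  also have "\<dots> \<le> (1 - t) / (1 + t) * (1 - derivative_weight t)"
    using t \<rho> mono weight1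
    by (intro mult_mono frac_le) (auto simp: \<rho>_def)
  finally show "(r ^ k) ^ 3 / (1 - r ^ k) \<le> (1 - t) / (1 + t) * (1 - derivative_weight t)"
    by (simp add: x_def)
qed

section \<open>The extremal functions\<close>

lemma support_functional_le:
  assumes "l \<in> support_functionals z0"
  shows "bounded_clinear l" and "cmod (l x) \<le> norm x"
proof -
  show "bounded_clinear l" using assms by (simp add: support_functionals_def)
  then show "cmod (l x) \<le> norm x"
    using onorm[OF bounded_clinearD(1), of l x] assms by (simp add: support_functionals_def)
qed

lemma extremal_fun_in_class:
  fixes l :: "'a::complex_banach \<Rightarrow> complex"
  assumes l: "bounded_clinear l" "\<And>x. cmod (l x) \<le> norm x" and a: "0 < a" "a < 1"
  shows "holomorphic_map (extremal_fun l a) (ball 0 1)"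
    and "extremal_fun l a ` ball 0 1 \<subseteq> closure (ball 0 1)"
    and "extremal_fun l a 0 = complex_of_real a"
proof -
  have nz: "1 - complex_of_real a * l z \<noteq> 0" if "norm z < 1" for z
    using one_minus_cnj_mult_nonzero[of "complex_of_real a" "l z"] a that l(2)[of z] by simp
  show "holomorphic_map (extremal_fun l a) (ball 0 1)"
    unfolding holomorphic_map_def
  proof (intro conjI ballI)
    fix z :: 'a assume "z \<in> ball 0 1"
    then have "norm z < 1" by simp
    define h where "h \<zeta> = (complex_of_real a - \<zeta>) / (1 - complex_of_real a * \<zeta>)" for \<zeta>
    have "h field_differentiable at (l z)"
      unfolding h_def using nz[OF \<open>norm z < 1\<close>] by (intro derivative_intros)
    then obtain h' where "(h has_field_derivative h') (at (l z))"
      unfolding field_differentiable_def by blast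
    then have "(h has_derivative (*) h') (at (l z))"
      by (simp add: has_field_derivative_def)
    moreover have "(l has_derivative l) (at z)"
      by (rule bounded_linear_imp_has_derivative[OF bounded_clinearD(1)[OF l(1)]])
    ultimately have "(h \<circ> l has_derivative (*) h' \<circ> l) (at z)"
      by (intro diff_chain_at)
    moreover have "h \<circ> l = extremal_fun l a"
      by (simp add: fun_eq_iff h_def extremal_fun_def)
    moreover have "bounded_clinear ((*) h' \<circ> l)"
      using bounded_linear_compose[OF bounded_linear_mult_right bounded_clinearD(1)[OF l(1)], of h']
      by (simp add: bounded_clinear_def o_def bounded_clinearD(2)[OF l(1)] scaleC_complex_def)
    ultimately show "\<exists>L. bounded_clinear L \<and> (extremal_fun l a has_derivative L) (at z)"
      by auto
  qed simp
  show "extremal_fun l a ` ball 0 1 \<subseteq> closure (ball 0 1)"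
  proof -
    have "cmod (extremal_fun l a z) \<le> 1" if z: "norm z < 1" for z
    proof -
      have "0 \<le> (1 - a\<^sup>2) * (1 - (cmod (l z))\<^sup>2)"
        using a l(2)[of z] z by (intro mult_nonneg_nonneg) (auto simp: power_le_one)
      moreover have "(cmod (1 - complex_of_real a * l z))\<^sup>2 - (cmod (l z - complex_of_real a))\<^sup>2
          = (1 - a\<^sup>2) * (1 - (cmod (l z))\<^sup>2)"
        using Moebius_defect[of "complex_of_real a" "l z"] by simp
      ultimately have "(cmod (l z - complex_of_real a))\<^sup>2 \<le> (cmod (1 - complex_of_real a * l z))\<^sup>2"
        by linarith
      then have "cmod (l z - complex_of_real a) \<le> cmod (1 - complex_of_real a * l z)"
        by (rule power2_le_imp_le) simp
      then show ?thesis
        using nz[OF z] by (simp add: extremal_fun_def norm_divide norm_minus_commute)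
    qed
    then show ?thesis by auto
  qed
  show "extremal_fun l a 0 = complex_of_real a"
    using bounded_clinear_scaleR[OF l(1), of 0 0] by (simp add: extremal_fun_def)
qed

text \<open>
  Both bounds of \<open>bohr_functional_bounds\<close> tend to one: \<open>extremal_fun l a w\<close> tends to
  \<open>(1 - l w) / (1 - l w) = 1\<close> and \<open>a\<close> is the value at zero.
\<close>

lemma bohr_functional_extremal_limit:
  fixes \<mu>k \<mu>m :: "'a::complex_banach \<Rightarrow> 'a"
  assumes l: "bounded_clinear l" "\<And>x. cmod (l x) \<le> norm x"
    and k: "norm (\<mu>k z) \<le> r ^ k" "r ^ k < 1" and m: "norm (\<mu>m z) < 1"
  shows "((\<lambda>a. bohr_functional k \<mu>k \<mu>m (extremal_fun l a) z r) \<longlongrightarrow> 1) (at_left 1)"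
proof -
  define w where "w = \<mu>m z"
  define c where "c = 1 - derivative_weight (norm w)"
  have "l w \<noteq> 1" using l(2)[of w] m by (auto simp: w_def)
  have "((\<lambda>a. extremal_fun l a w) \<longlongrightarrow> (complex_of_real 1 - l w) / (1 - complex_of_real 1 * l w)) (at_left 1)"
    unfolding extremal_fun_def using \<open>l w \<noteq> 1\<close> by (intro tendsto_intros) auto
  then have "((\<lambda>a. extremal_fun l a w) \<longlongrightarrow> 1) (at_left 1)"
    using \<open>l w \<noteq> 1\<close> by simp
  then have lim: "((\<lambda>a. (cmod (extremal_fun l a w))\<^sup>2) \<longlongrightarrow> 1) (at_left 1)"
    by (auto intro!: tendsto_eq_intros)
  show ?thesis
  proof (rule tendsto_sandwich)
    show "\<forall>\<^sub>F a in at_left 1. (cmod (extremal_fun l a w))\<^sup>2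
        \<le> bohr_functional k \<mu>k \<mu>m (extremal_fun l a) z r"
      using bohr_functional_bounds(2)[where \<mu>k = \<mu>k and \<mu>m = \<mu>m and z = z and r = r and k = k, OF _ _ k m]
        extremal_fun_in_class[OF l] unfolding w_def
      by (intro eventually_at_leftI[of 0 1]) auto
    show "\<forall>\<^sub>F a in at_left 1. bohr_functional k \<mu>k \<mu>m (extremal_fun l a) z r
        \<le> 1 - (1 - (cmod (extremal_fun l a w))\<^sup>2) * c + (1 - a\<^sup>2) * (r ^ k) ^ 3 / (1 - r ^ k)"
    proof (rule eventually_at_leftI[of 0 1])
      fix a :: real assume "a \<in> {0<..<1}"
      then have a: "0 < a" "a < 1" by auto
      show "bohr_functional k \<mu>k \<mu>m (extremal_fun l a) z r
        \<le> 1 - (1 - (cmod (extremal_fun l a w))\<^sup>2) * c + (1 - a\<^sup>2) * (r ^ k) ^ 3 / (1 - r ^ k)"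
        using bohr_functional_bounds(3)[where \<mu>k = \<mu>k and \<mu>m = \<mu>m and z = z and r = r and k = k, OF extremal_fun_in_class(1,2)[OF l a] k m]
        by (simp add: extremal_fun_in_class(3)[OF l a] w_def c_def)
    qed simp
    have "((\<lambda>a. 1 - (1 - (cmod (extremal_fun l a w))\<^sup>2) * c + (1 - a\<^sup>2) * (r ^ k) ^ 3 / (1 - r ^ k))
        \<longlongrightarrow> 1 - (1 - 1) * c + (1 - 1\<^sup>2) * (r ^ k) ^ 3 / (1 - r ^ k)) (at_left 1)"
      using k(2) by (intro tendsto_intros lim) auto
    then show "((\<lambda>a. 1 - (1 - (cmod (extremal_fun l a w))\<^sup>2) * c + (1 - a\<^sup>2) * (r ^ k) ^ 3 / (1 - r ^ k))
        \<longlongrightarrow> 1) (at_left 1)"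
      by simp
  qed (rule lim)
qed

section \<open>The refined Bohr inequality\<close>

theorem theorem3p2:
  fixes F :: "'a::complex_banach \<Rightarrow> complex"
    and \<mu>k \<mu>m :: "'a \<Rightarrow> 'a"
    and k m :: nat
  assumes "k \<ge> 1" and "m \<ge> 1"
    and "holomorphic_map F (ball 0 1)" and "F ` ball 0 1 \<subseteq> closure (ball 0 1)"
    and "schwarz_mapping \<mu>k" and "zero_of_order k \<mu>k"
    and "schwarz_mapping \<mu>m" and "zero_of_order m \<mu>m"
  shows
    "{r. 0 < r \<and> r < 1 \<and> R2_equation m r} = {R2 m} \<and>
     (0 < R2k m k \<and> R2k m k < 1 \<and> R2k_equation m k (R2k m k) \<and>
       (\<forall>r. 0 < r \<and> R2k_equation m k r \<longrightarrow> R2k m k \<le> r)) \<and>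
     (\<forall>z r. norm z = r \<and> r \<le> R2k m k \<longrightarrow>
       bohr_summable F \<mu>k z \<and> bohr_functional k \<mu>k \<mu>m F z r \<le> 1) \<and>
     (\<forall>z0 l. norm z0 = 1 \<and> l \<in> support_functionals z0 \<longrightarrow>
       (\<forall>z r. z \<in> ball 0 1 \<and> norm z = r \<longrightarrow>
         (\<forall>a. 0 < a \<and> a < 1 \<longrightarrow> bohr_summable (extremal_fun l a) \<mu>k z) \<and>
         ((\<lambda>a. bohr_functional k \<mu>k \<mu>m (extremal_fun l a) z r) \<longlongrightarrow> 1) (at_left 1)))"
proof (intro conjI allI impI)
  note radii = R2k_least_root[OF assms(2,1)]
  show "{r. 0 < r \<and> r < 1 \<and> R2_equation m r} = {R2 m}"
    by (rule R2_unique_root[OF assms(2)])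
  show "0 < R2k m k" "R2k m k < 1" "R2k_equation m k (R2k m k)"
    by (rule radii)+
  show "R2k m k \<le> r" if "0 < r \<and> R2k_equation m k r" for r
    using radii(4) that by simp
  have schwarz: "norm (\<mu>k z) \<le> norm z ^ k" "norm z ^ k < 1"
    "norm (\<mu>m z) \<le> norm z ^ m" "norm z ^ m < 1" "norm (\<mu>m z) < 1" if "norm z < 1" for z
  proof -
    show "norm (\<mu>k z) \<le> norm z ^ k" "norm (\<mu>m z) \<le> norm z ^ m"
      using assms that by (auto intro: Schwarz_mapping_bound)
    show "norm z ^ k < 1" "norm z ^ m < 1"
      using that assms(1,2) by (auto intro!: power_less_one_iff[THEN iffD2])
    then show "norm (\<mu>m z) < 1" using \<open>norm (\<mu>m z) \<le> norm z ^ m\<close> by linarith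
  qed
  {
    fix z :: 'a and r :: real
    assume zr: "norm z = r \<and> r \<le> R2k m k"
    then have r: "0 \<le> r" "r \<le> R2k m k" and z: "norm z < 1" using radii(2) by auto
    note s = schwarz[OF z, unfolded conjunct1[OF zr]]
    show "bohr_summable F \<mu>k z"
      by (rule bohr_functional_bounds(1)[where \<mu>k = \<mu>k and \<mu>m = \<mu>m and z = z and r = r and k = k, OF assms(3,4) s(1,2,5)])
    define t where "t = norm (\<mu>m z)"
    have t: "0 \<le> t" "t \<le> r ^ m" "t < 1" using s(3,5) by (auto simp: t_def)
    note weight = R2k_fun_nonpos_imp[OF r(1) s(4,2) radii(5)[OF r] t(1,2)]
    define A where "A = 1 - (cmod (F 0))\<^sup>2"
    have "0 \<le> A"
      using derivative_part_le(3)[OF assms(3,4), of 0] by (simp add: A_def power_le_one)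
    have "A * ((r ^ k) ^ 3 / (1 - r ^ k)) \<le> A * ((1 - t) / (1 + t) * (1 - derivative_weight t))"
      using weight(2) \<open>0 \<le> A\<close> by (rule mult_left_mono)
    also have "\<dots> = A * (1 - t) / (1 + t) * (1 - derivative_weight t)" by simp
    also have "\<dots> \<le> (1 - (cmod (F (\<mu>m z)))\<^sup>2) * (1 - derivative_weight t)"
      using derivative_part_le(2)[OF assms(3,4) s(5)] weight(1)
      by (intro mult_right_mono) (auto simp: A_def t_def)
    finally show "bohr_functional k \<mu>k \<mu>m F z r \<le> 1"
      using bohr_functional_bounds(3)[where \<mu>k = \<mu>k and \<mu>m = \<mu>m and z = z and r = r and k = k, OF assms(3,4) s(1,2,5)]
      by (simp add: A_def t_def)
  }
  {
    fix z0 z :: 'a and l and r a :: real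
    assume l: "norm z0 = 1 \<and> l \<in> support_functionals z0" and zr: "z \<in> ball 0 1 \<and> norm z = r"
    then have z: "norm z < 1" by simp
    note s = schwarz[OF z, unfolded conjunct2[OF zr]]
    note l' = support_functional_le[OF conjunct2[OF l]]
    show "bohr_summable (extremal_fun l a) \<mu>k z" if "0 < a \<and> a < 1"
      using bohr_functional_bounds(1)[where \<mu>k = \<mu>k and \<mu>m = \<mu>m and z = z and r = r and k = k, OF extremal_fun_in_class(1,2)[OF l', of a] s(1,2,5)] that by blast
    show "((\<lambda>a. bohr_functional k \<mu>k \<mu>m (extremal_fun l a) z r) \<longlongrightarrow> 1) (at_left 1)"
      by (rule bohr_functional_extremal_limit[where \<mu>k = \<mu>k and \<mu>m = \<mu>m and z = z and r = r and k = k, OF l' s(1,2,5)])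
  }
qed

end
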